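(* For the general Geronimus transformation $\check{\vec w}$ of $\vec w=(w_1,w_2)$ by the polynomial $\tilde P(x)=p(x^2)P(x)$ of degree $\tilde N=2M+N$, and for $n\ge\tilde N$, the mixed Christoffel–Darboux kernels satisfy $$\pi(x)p(x)\begin{bmatrix}\check K^{(n)}_{1,1}(x,y)&\check K^{(n)}_{1,2}(x,y)\\ \check K^{(n)}_{2,1}(x,y)&\check K^{(n)}_{2,2}(x,y)\end{bmatrix} =\begin{bmatrix}\tilde P_{\mathrm e}(y)&y\tilde P_{\mathrm o}(y)\\ \tilde P_{\mathrm o}(y)&\tilde P_{\mathrm e}(y)\end{bmatrix}\begin{bmatrix}K^{(n)}_{1,1}(x,y)&K^{(n)}_{1,2}(x,y)\\ K^{(n)}_{2,1}(x,y)&K^{(n)}_{2,2}(x,y)\end{bmatrix}\begin{bmatrix}P_{\mathrm e}(x)&-xP_{\mathrm o}(x)\\ -P_{\mathrm o}(x)&P_{\mathrm e}(x)\end{bmatrix}$$ $$+\begin{bmatrix}\mathscr V_{1,1}^{\tilde P_{\mathrm e}}(x,y)+\mathscr V_{1,2}^{\tilde P_{\mathrm o}}(x,y)&\mathscr V_{1,1}^{x\tilde P_{\mathrm o}}(x,y)+\mathscr V_{1,2}^{\tilde P_{\mathrm e}}(x,y)\\ \mathscr V_{2,1}^{\tilde P_{\mathrm e}}(x,y)+\mathscr V_{2,2}^{\tilde P_{\mathrm o}}(x,y)&\mathscr V_{2,1}^{x\tilde P_{\mathrm o}}(x,y)+\mathscr V_{2,2}^{\tilde P_{\mathrm e}}(x,y)\end{bmatrix}\begin{bmatrix}P_{\mathrm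 e}(x)&-xP_{\mathrm o}(x)\\ -P_{\mathrm o}(x)&P_{\mathrm e}(x)\end{bmatrix}$$ $$-\begin{bmatrix}\check A_1^{(n)}(y)&\cdots&\check A_1^{(n+\tilde N-1)}(y)\\ \check A_2^{(n)}(y)&\cdots&\check A_2^{(n+\tilde N-1)}(y)\end{bmatrix}\Omega[n]^\top\begin{bmatrix}V_1^{(n-\tilde N)}(x)&V_2^{(n-\tilde N)}(x)\\ \vdots&\vdots\\ V_1^{(n-1)}(x)&V_2^{(n-1)}(x)\end{bmatrix}.$$
   Context: Let $\Delta\subset\mathbb R$ be an interval and $w_1,w_2$ weight functions on $\Delta$ with all moments finite with respect to $\mathrm dx$. All vectors and matrices are semi-infinite, indexed by $0,1,2,\dots$. Put $X(x)=(1,x,x^2,\dots)^\top$, $X_1(x)=(1,0,x,0,x^2,0,\dots)^\top$, $X_2(x)=(0,1,0,x,0,x^2,\dots)^\top$. For a pair of weights $\vec u=(u_1,u_2)$, $g_{\vec u}=\int_\Delta X\big(X_1u_1+X_2u_2\big)^\top\mathrm dx$. Perturbing polynomial: $P(x)=(x-x_1)\cdots(x-x_N)\in\mathbb R[x]$ is monic and non-symmetric (if $x_0\neq0$ is a root, then $-x_0$ is not), $p(x)=(x-r_1^2)\cdots(x-r_M^2)\in\mathbb R[x]$, $\tilde P(x)=p(x^2)P(x)$, $\tilde N=2M+N$. Write $P(x)=P_{\mathrm e}(x^2)+xP_{\mathrm o}(x^2)$; $\tilde P_{\mathrm e}=pP_{\mathrm e}$, $\tilde P_{\mathrm o}=pP_{\mathrm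 o}$; $\pi(x)=P_{\mathrm e}(x)^2-xP_{\mathrm o}(x)^2$, whose zeros are $x_1^2,\dots,x_N^2$. The zeros $Z=\{r_1^2,\dots,r_M^2,x_1^2,\dots,x_N^2\}$ of $p\pi$ are assumed pairwise distinct. Geronimus perturbation: $\check{\vec w}=(\check w_1,\check w_2)$ satisfies $\check{\vec w}\begin{bmatrix}\tilde P_{\mathrm e}(x)&x\tilde P_{\mathrm o}(x)\\ \tilde P_{\mathrm o}(x)&\tilde P_{\mathrm e}(x)\end{bmatrix}=\vec w$, which gives $$\check{\vec w}=\frac1{\pi(x)p(x)}\vec w\begin{bmatrix}P_{\mathrm e}(x)&-xP_{\mathrm o}(x)\\ -P_{\mathrm o}(x)&P_{\mathrm e}(x)\end{bmatrix}+\vec c(x)\sum_{\zeta\in Z}\delta(x-\zeta)$$ for some vector function $\vec c=(c_1,c_2)$, $\delta$ being Dirac's delta. Integrals $\int_\Delta$ involving $\check w_a$ include the contributions of these masses (a mass at $\zeta$ in $\check w_a$ contributes $c_a(\zeta)f(\zeta)$ to $\int f\check w_a$). It is assumed that $g_{\vec w}=S^{-1}H\tilde S^{-\top}$ and $g_{\check{\vec w}}=\check S^{-1}\check H\check{\tilde S}^{-\top}$ with lower unitriangular $S,\tilde S,\check S,\check{\tilde S}$ and diagonal $H,\check H$ with nonzero entries. $B=SX$, $A_a=H^{-1}\tilde SX_a$, $\check B=\check SX$, $\check A_a=\check H^{-1}\check{\tilde S}X_a$, $a\in\{1,2\}$, with entries indexed by superscripts. The connection matrix is $\Omega=\check SS^{-1}$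 (lower unitriangular with at most $\tilde N$ nonzero subdiagonals), and $\Omega[n]$ is the $\tilde N\times\tilde N$ matrix with entries $(\Omega[n])_{j,i}=\Omega_{n+i,\,n-\tilde N+j}$, $0\le i,j\le\tilde N-1$ (zero for $i>j$). Second kind functions: $C_a(z)=\int_\Delta\frac{B(x)}{z-x}w_a(x)\,\mathrm dx$, $\check C_a(z)=\int_\Delta\frac{\check B(x)}{z-x}\check w_a(x)\,\mathrm dx$. Mixed kernels: $K_{a,b}^{(n)}(x,y)=\sum_{l=0}^{n-1}C_b^{(l)}(x)A_a^{(l)}(y)$, $\check K_{a,b}^{(n)}(x,y)=\sum_{l=0}^{n-1}\check C_b^{(l)}(x)\check A_a^{(l)}(y)$. Further $$V_1^{(n)}(x)=P_{\mathrm e}(x)C_1^{(n)}(x)-P_{\mathrm o}(x)C_2^{(n)}(x),\qquad V_2^{(n)}(x)=-xP_{\mathrm o}(x)C_1^{(n)}(x)+P_{\mathrm e}(x)C_2^{(n)}(x),$$ and for a polynomial $R$ and $a,b\in\{1,2\}$, $$\mathscr V_{a,b}^{R}(x,y)=\int_\Delta\sum_{l=0}^{n-1}\check B^{(l)}(t)\check A_a^{(l)}(y)\,\check w_b(t)\,\frac{R(x)-R(t)}{x-t}\,\mathrm dt$$ (superscript $x\tilde P_{\mathrm o}$ means $R(x)=x\tilde P_{\mathrm o}(x)$). *)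

theory Defs
  imports
    "HOL-Analysis.Analysis"
    "HOL-Library.Groups_Big_Fun"
    "HOL-Computational_Algebra.Polynomial"
    "Jordan_Normal_Form.Matrix"
begin

hide_const (open) Finite_Cartesian_Product.mat Finite_Cartesian_Product.vec

section \<open>Semi-infinite matrices and vectors\<close>

type_synonym imat = "nat \<Rightarrow> nat \<Rightarrow> complex"
type_synonym ivec = "nat \<Rightarrow> complex"

text \<open>\<^const>\<open>Sum_any\<close> sums over the support of the summand. In every product
  used here that support is finite, since the left factor is lower triangular.\<close>

definition imat_mult :: "imat \<Rightarrow> imat \<Rightarrow> imat" (infixr "\<star>" 70) where
  "A \<star> B = (\<lambda>i j. Sum_any (\<lambda>k. A i k * B k j))"

definition imat_vec :: "imat \<Rightarrow> ivec \<Rightarrow> ivec" (infixr "\<star>\<^sub>v" 70) where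
  "A \<star>\<^sub>v v = (\<lambda>i. Sum_any (\<lambda>k. A i k * v k))"

definition imat_one :: imat where
  "imat_one = (\<lambda>i j. if i = j then 1 else 0)"

definition imat_transpose :: "imat \<Rightarrow> imat" where
  "imat_transpose A = (\<lambda>i j. A j i)"

definition lower_tri :: "imat \<Rightarrow> bool" where
  "lower_tri A \<longleftrightarrow> (\<forall>i j. i < j \<longrightarrow> A i j = 0)"

definition lower_unitri :: "imat \<Rightarrow> bool" where
  "lower_unitri A \<longleftrightarrow> lower_tri A \<and> (\<forall>i. A i i = 1)"

definition nonsing_diag :: "imat \<Rightarrow> bool" where
  "nonsing_diag A \<longleftrightarrow> (\<forall>i j. i \<noteq> j \<longrightarrow> A i j = 0) \<and> (\<forall>i. A i i \<noteq> 0)"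

text \<open>The inverse within the algebra of lower triangular matrices; by
  \<open>ex1_imat_inv\<close> below it exists uniquely whenever the diagonal entries are nonzero.\<close>

definition imat_inv :: "imat \<Rightarrow> imat" where
  "imat_inv A = (THE L. lower_tri L \<and> A \<star> L = imat_one \<and> L \<star> A = imat_one)"

lemma imat_mult_lower:
  assumes "lower_tri A"
  shows "(A \<star> B) i j = (\<Sum>k\<le>i. A i k * B k j)"
proof -
  have "{k. A i k * B k j \<noteq> 0} \<subseteq> {..i}"
    using assms by (auto simp: lower_tri_def not_le[symmetric])
  then show ?thesis
    unfolding imat_mult_def by (intro Sum_any.expand_superset) auto
qed

lemma lower_tri_mult:
  assumes "lower_tri A" "lower_tri B"
  shows "lower_tri (A \<star> B)"
  unfolding lower_tri_def
proof (intro allI impI)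
  fix i j :: nat
  assume "i < j"
  then have "B k j = 0" if "k \<le> i" for k
    using that assms(2) by (auto simp: lower_tri_def)
  then show "(A \<star> B) i j = 0"
    by (simp add: imat_mult_lower[OF assms(1)])
qed

lemma imat_mult_assoc:
  assumes A: "lower_tri A" and B: "lower_tri B"
  shows "(A \<star> B) \<star> C = A \<star> (B \<star> C)"
proof (intro ext)
  fix i j
  have inner: "(\<Sum>k\<le>i. B l k * C k j) = (\<Sum>k\<le>l. B l k * C k j)" if "l \<le> i" for l
    using that B by (intro sum.mono_neutral_right) (auto simp: lower_tri_def not_le)
  have "((A \<star> B) \<star> C) i j = (\<Sum>k\<le>i. (\<Sum>l\<le>i. A i l * B l k) * C k j)"
    by (simp add: imat_mult_lower[OF lower_tri_mult[OF A B]] imat_mult_lower[OF A])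
  also have "\<dots> = (\<Sum>k\<le>i. \<Sum>l\<le>i. A i l * (B l k * C k j))"
    by (simp add: sum_distrib_right mult.assoc)
  also have "\<dots> = (\<Sum>l\<le>i. \<Sum>k\<le>i. A i l * (B l k * C k j))"
    by (rule sum.swap)
  also have "\<dots> = (\<Sum>l\<le>i. A i l * (\<Sum>k\<le>l. B l k * C k j))"
    by (intro sum.cong) (auto simp: inner sum_distrib_left[symmetric])
  also have "\<dots> = (A \<star> (B \<star> C)) i j"
    by (simp add: imat_mult_lower[OF A] imat_mult_lower[OF B])
  finally show "((A \<star> B) \<star> C) i j = (A \<star> (B \<star> C)) i j" .
qed

lemma lower_tri_one: "lower_tri imat_one"
  by (simp add: lower_tri_def imat_one_def)

lemma imat_one_mult: "imat_one \<star> A = A"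
proof (intro ext)
  fix i j
  have "(imat_one \<star> A) i j = (\<Sum>k\<le>i. imat_one i k * A k j)"
    by (rule imat_mult_lower[OF lower_tri_one])
  also have "\<dots> = (\<Sum>k\<le>i. if k = i then A k j else 0)"
    by (intro sum.cong) (auto simp: imat_one_def)
  finally show "(imat_one \<star> A) i j = A i j"
    by simp
qed

lemma imat_mult_one:
  assumes "lower_tri A"
  shows "A \<star> imat_one = A"
proof (intro ext)
  fix i j
  have "(A \<star> imat_one) i j = (\<Sum>k\<le>i. if k = j then A i k else 0)"
    unfolding imat_mult_lower[OF assms] by (intro sum.cong) (auto simp: imat_one_def)
  then show "(A \<star> imat_one) i j = A i j"
    using assms by (auto simp: lower_tri_def not_le)
qed

function lower_rinv :: "imat \<Rightarrow> imat" where
  "lower_rinv A i j = (if i < j then 0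
     else ((if i = j then 1 else 0) - (\<Sum>k\<in>{..<i}. A i k * lower_rinv A k j)) / A i i)"
  by auto
termination by (relation "Wellfounded.measure (\<lambda>(A, i, j). i)") auto

declare lower_rinv.simps [simp del]

lemma lower_rinv:
  assumes "lower_tri A" "\<And>i. A i i \<noteq> 0"
  shows "lower_tri (lower_rinv A)" "A \<star> lower_rinv A = imat_one" "lower_rinv A i i \<noteq> 0"
proof -
  show L: "lower_tri (lower_rinv A)"
    unfolding lower_tri_def by (subst lower_rinv.simps) auto
  show "A \<star> lower_rinv A = imat_one"
  proof (intro ext)
    fix i j
    have split: "(A \<star> lower_rinv A) i j
        = (\<Sum>k\<in>{..<i}. A i k * lower_rinv A k j) + A i i * lower_rinv A i j"
      by (simp add: imat_mult_lower[OF assms(1)] lessThan_Suc_atMost[symmetric])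
    show "(A \<star> lower_rinv A) i j = imat_one i j"
    proof (cases "i < j")
      case True
      then have "lower_rinv A k j = 0" if "k \<le> i" for k
        using that L by (auto simp: lower_tri_def)
      then show ?thesis
        using True by (simp add: split imat_one_def)
    next
      case False
      then show ?thesis
        unfolding split lower_rinv.simps[of A i j] using assms(2)[of i] by (simp add: imat_one_def)
    qed
  qed
  have "(\<Sum>k\<in>{..<i}. A i k * lower_rinv A k i) = 0"
    using L by (intro sum.neutral) (auto simp: lower_tri_def)
  then show "lower_rinv A i i \<noteq> 0"
    using assms(2)[of i] by (subst lower_rinv.simps) simp
qed

lemma ex1_imat_inv:
  assumes A: "lower_tri A" and d: "\<And>i. A i i \<noteq> 0"
  shows "\<exists>!L. lower_tri L \<and> A \<star> L = imat_one \<and> L \<star> A = imat_one"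
proof (rule ex1I)
  define R where "R = lower_rinv A"
  define Q where "Q = lower_rinv R"
  have R: "lower_tri R" "A \<star> R = imat_one" "\<And>i. R i i \<noteq> 0"
    using lower_rinv[of A] A d by (auto simp: R_def)
  have Q: "lower_tri Q" "R \<star> Q = imat_one"
    using lower_rinv[of R] R by (auto simp: Q_def)
  have "A = A \<star> (R \<star> Q)"
    by (simp add: Q imat_mult_one[OF A])
  also have "\<dots> = Q"
    by (simp add: imat_mult_assoc[OF A R(1), symmetric] R imat_one_mult)
  finally have "R \<star> A = imat_one"
    using Q by simp
  then show *: "lower_tri R \<and> A \<star> R = imat_one \<and> R \<star> A = imat_one"
    using R by simp
  fix L
  assume L: "lower_tri L \<and> A \<star> L = imat_one \<and> L \<star> A = imat_one"
  have "L = L \<star> (A \<star> R)"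
    using L by (simp add: R imat_mult_one)
  also have "\<dots> = R"
    using L A by (simp add: imat_mult_assoc[symmetric] imat_one_mult)
  finally show "L = R" .
qed

section \<open>Weights with point masses\<close>

text \<open>\<open>GWeight v m\<close> stands for \<open>v(x) dx + \<Sum>\<^sub>\<zeta> m(\<zeta>) \<delta>(x - \<zeta>)\<close>. The masses sit at
  arbitrary complex points (real polynomials may have nonreal zeros), independently of the
  interval of integration; test functions are therefore functions of a complex variable.\<close>

datatype gweight = GWeight (ac_density: "real \<Rightarrow> real") (point_masses: "complex \<Rightarrow> complex")

definition gint :: "real set \<Rightarrow> gweight \<Rightarrow> (complex \<Rightarrow> complex) \<Rightarrow> complex" where
  "gint \<Delta> u f = (LINT t:\<Delta>|lborel. f (of_real t) * of_real (ac_density u t))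
     + Sum_any (\<lambda>\<zeta>. point_masses u \<zeta> * f \<zeta>)"

definition finite_moments :: "real set \<Rightarrow> gweight \<Rightarrow> bool" where
  "finite_moments \<Delta> u \<longleftrightarrow> finite {\<zeta>. point_masses u \<zeta> \<noteq> 0} \<and>
     (\<forall>k::nat. set_integrable lborel \<Delta> (\<lambda>t. t ^ k * ac_density u t))"

definition no_masses :: "(real \<Rightarrow> real) \<Rightarrow> gweight" where
  "no_masses v = GWeight v (\<lambda>_. 0)"

abbreviation cpoly :: "real poly \<Rightarrow> complex \<Rightarrow> complex" where
  "cpoly R z \<equiv> poly (map_poly of_real R) z"

definition gw_add :: "gweight \<Rightarrow> gweight \<Rightarrow> gweight" where
  "gw_add u v = GWeight (\<lambda>t. ac_density u t + ac_density v t) (\<lambda>\<zeta>. point_masses u \<zeta> + point_masses v \<zeta>)"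

definition gw_poly_mult :: "real poly \<Rightarrow> gweight \<Rightarrow> gweight" where
  "gw_poly_mult R u = GWeight (\<lambda>t. poly R t * ac_density u t) (\<lambda>\<zeta>. cpoly R \<zeta> * point_masses u \<zeta>)"

definition gw_eq_on :: "real set \<Rightarrow> gweight \<Rightarrow> gweight \<Rightarrow> bool" where
  "gw_eq_on \<Delta> u v \<longleftrightarrow>
     (AE t in lborel. t \<in> \<Delta> \<longrightarrow> ac_density u t = ac_density v t) \<and> point_masses u = point_masses v"

section \<open>Mixed-type polynomials, second kind functions and kernels\<close>

text \<open>Pairs of weights, and all other objects carrying an index in \<open>{1, 2}\<close>, are functions of a
  natural number, of which only the values at 1 and 2 matter.\<close>

definition Xvec :: "complex \<Rightarrow> ivec" where
  "Xvec x = (\<lambda>k. x ^ k)"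

definition Xvec_part :: "nat \<Rightarrow> complex \<Rightarrow> ivec" where
  "Xvec_part a x = (\<lambda>k. if (if a = 1 then even k else odd k) then x ^ (k div 2) else 0)"

definition moment_matrix :: "real set \<Rightarrow> (nat \<Rightarrow> gweight) \<Rightarrow> imat" where
  "moment_matrix \<Delta> u = (\<lambda>i j.
     gint \<Delta> (u 1) (\<lambda>x. Xvec x i * Xvec_part 1 x j) + gint \<Delta> (u 2) (\<lambda>x. Xvec x i * Xvec_part 2 x j))"

definition LDU_factorization :: "imat \<Rightarrow> imat \<Rightarrow> imat \<Rightarrow> imat \<Rightarrow> bool" where
  "LDU_factorization g S H S' \<longleftrightarrow>
     lower_unitri S \<and> lower_unitri S' \<and> nonsing_diag H \<and>
     g = imat_inv S \<star> H \<star> imat_transpose (imat_inv S')"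

definition Bpol :: "imat \<Rightarrow> complex \<Rightarrow> ivec" where
  "Bpol S x = S \<star>\<^sub>v Xvec x"

definition Apol :: "imat \<Rightarrow> imat \<Rightarrow> nat \<Rightarrow> complex \<Rightarrow> ivec" where
  "Apol H S' a x = imat_inv H \<star>\<^sub>v S' \<star>\<^sub>v Xvec_part a x"

definition second_kind ::
  "real set \<Rightarrow> (nat \<Rightarrow> gweight) \<Rightarrow> imat \<Rightarrow> nat \<Rightarrow> complex \<Rightarrow> ivec" where
  "second_kind \<Delta> u S a z = (\<lambda>n. gint \<Delta> (u a) (\<lambda>x. Bpol S x n / (z - x)))"

text \<open>The set of points at which the second kind functions of \<open>u\<close> are defined:
  the Cauchy integrals of the densities converge absolutely and there is no mass.\<close>

definition cauchy_domain :: "real set \<Rightarrow> (nat \<Rightarrow> gweight) \<Rightarrow> complex set" where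
  "cauchy_domain \<Delta> u = {z. \<forall>a\<in>{1, 2}. point_masses (u a) z = 0 \<and>
     set_integrable lborel \<Delta> (\<lambda>t. of_real (ac_density (u a) t) / (z - of_real t))}"

lemma in_cauchy_domain:
  assumes mom: "finite_moments \<Delta> (u 1)" "finite_moments \<Delta> (u 2)"
    and z: "z \<notin> of_real ` closure \<Delta>" "point_masses (u 1) z = 0" "point_masses (u 2) z = 0"
  shows "z \<in> cauchy_domain \<Delta> u"
proof -
  have "set_integrable lborel \<Delta> (\<lambda>t. of_real (ac_density (u a) t) / (z - of_real t))"
    if a: "a \<in> {1, 2}" for a :: nat
  proof -
    have int: "integrable lborel (\<lambda>t. indicator \<Delta> t * ac_density (u a) t)"
      using mom a unfolding finite_moments_def set_integrable_def
      by (auto dest!: spec[of _ "0::nat"])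
    have "closed (of_real ` closure \<Delta> :: complex set)"
      by (intro closed_injective_linear_image) (auto simp: linear_of_real inj_on_def)
    then obtain d where d: "d > 0" "\<And>t. t \<in> closure \<Delta> \<Longrightarrow> d \<le> dist z (of_real t)"
      using separate_point_closed[OF _ z(1)] by (metis imageI)
    show ?thesis
      unfolding set_integrable_def
    proof (rule Bochner_Integration.integrable_bound)
      show "integrable lborel (\<lambda>t. (1 / d) * (indicator \<Delta> t * ac_density (u a) t))"
        using int by (rule integrable_mult_right)
      have "(\<lambda>t. complex_of_real (indicator \<Delta> t * ac_density (u a) t) / (z - of_real t))
              \<in> borel_measurable lborel"
        using int by measurable
      also have "(\<lambda>t. complex_of_real (indicator \<Delta> t * ac_density (u a) t) / (z - of_real t))
          = (\<lambda>t. indicator \<Delta> t *\<^sub>R (complex_of_real (ac_density (u a) t) / (z - of_real t)))"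
        by (auto simp: fun_eq_iff scaleR_conv_of_real)
      finally show "(\<lambda>t. indicator \<Delta> t *\<^sub>R (complex_of_real (ac_density (u a) t) / (z - of_real t)))
          \<in> borel_measurable lborel" .
      show "AE t in lborel. norm (indicator \<Delta> t *\<^sub>R (complex_of_real (ac_density (u a) t) / (z - of_real t)))
          \<le> norm ((1 / d) * (indicator \<Delta> t * ac_density (u a) t))"
      proof (rule AE_I2)
        fix t
        show "norm (indicator \<Delta> t *\<^sub>R (complex_of_real (ac_density (u a) t) / (z - of_real t)))
          \<le> norm ((1 / d) * (indicator \<Delta> t * ac_density (u a) t))"
        proof (cases "t \<in> \<Delta>")
          case True
          then have "d \<le> norm (z - of_real t)"
            using d(2) closure_subset by (auto simp: dist_norm)
          then have "\<bar>ac_density (u a) t\<bar> / norm (z - of_real t) \<le> \<bar>ac_density (u a) t\<bar> / d"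
            using d(1) by (intro divide_left_mono mult_pos_pos) auto
          then show ?thesis
            using True d(1) by (simp add: norm_divide abs_mult)
        qed simp
      qed
    qed
  qed
  then show ?thesis
    using z by (auto simp: cauchy_domain_def)
qed

definition mixed_kernel ::
  "real set \<Rightarrow> (nat \<Rightarrow> gweight) \<Rightarrow> imat \<Rightarrow> imat \<Rightarrow> imat \<Rightarrow> nat
    \<Rightarrow> nat \<Rightarrow> nat \<Rightarrow> complex \<Rightarrow> complex \<Rightarrow> complex"
  where
  "mixed_kernel \<Delta> u S H S' n a b x y = (\<Sum>l<n. second_kind \<Delta> u S b x l * Apol H S' a y l)"

definition kernel_correction ::
  "real set \<Rightarrow> (nat \<Rightarrow> gweight) \<Rightarrow> imat \<Rightarrow> imat \<Rightarrow> imat \<Rightarrow> nat \<Rightarrow> real poly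
    \<Rightarrow> nat \<Rightarrow> nat \<Rightarrow> complex \<Rightarrow> complex \<Rightarrow> complex"
  where
  "kernel_correction \<Delta> u S H S' n R a b x y =
     gint \<Delta> (u b) (\<lambda>t. (\<Sum>l<n. Bpol S t l * Apol H S' a y l) * ((cpoly R x - cpoly R t) / (x - t)))"

section \<open>The Geronimus perturbation\<close>

definition nonsymmetric :: "real poly \<Rightarrow> bool" where
  "nonsymmetric P \<longleftrightarrow> (\<forall>z. z \<noteq> 0 \<and> cpoly P z = 0 \<longrightarrow> cpoly P (- z) \<noteq> 0)"

definition pi_poly :: "real poly \<Rightarrow> real poly \<Rightarrow> real poly" where
  "pi_poly Pe Po = Pe ^ 2 - [:0, 1:] * Po ^ 2"

definition geronimus_weight ::
  "(nat \<Rightarrow> real \<Rightarrow> real) \<Rightarrow> real poly \<Rightarrow> real poly \<Rightarrow> real poly \<Rightarrow> complex set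
    \<Rightarrow> (nat \<Rightarrow> complex \<Rightarrow> complex) \<Rightarrow> nat \<Rightarrow> gweight"
  where
  "geronimus_weight w Pe Po p Z c a = GWeight
     (\<lambda>t. (if a = 1 then w 1 t * poly Pe t - w 2 t * poly Po t
           else - (w 1 t * (t * poly Po t)) + w 2 t * poly Pe t)
          / (poly (pi_poly Pe Po) t * poly p t))
     (\<lambda>\<zeta>. if \<zeta> \<in> Z then c a \<zeta> else 0)"

text \<open>The defining equation of the perturbation. For a \<open>geronimus_weight\<close> it holds
  automatically for the densities, but it restricts the masses at the zeros of \<open>pi_poly\<close>:
  there the row vector of masses has to lie in the left kernel of the matrix.\<close>

definition geronimus_equation ::
  "real set \<Rightarrow> (nat \<Rightarrow> real \<Rightarrow> real) \<Rightarrow> real poly \<Rightarrow> real poly \<Rightarrow> (nat \<Rightarrow> gweight) \<Rightarrow> bool"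
  where
  "geronimus_equation \<Delta> w Pet Pot u \<longleftrightarrow>
     gw_eq_on \<Delta> (gw_add (gw_poly_mult Pet (u 1)) (gw_poly_mult Pot (u 2))) (no_masses (w 1)) \<and>
     gw_eq_on \<Delta> (gw_add (gw_poly_mult ([:0, 1:] * Pot) (u 1)) (gw_poly_mult Pet (u 2))) (no_masses (w 2))"

definition Vfun ::
  "real poly \<Rightarrow> real poly \<Rightarrow> (nat \<Rightarrow> complex \<Rightarrow> ivec) \<Rightarrow> nat \<Rightarrow> complex \<Rightarrow> ivec" where
  "Vfun Pe Po C a x = (\<lambda>n.
     if a = 1 then cpoly Pe x * C 1 x n - cpoly Po x * C 2 x n
     else - x * cpoly Po x * C 1 x n + cpoly Pe x * C 2 x n)"

abbreviation mat22 :: "complex \<Rightarrow> complex \<Rightarrow> complex \<Rightarrow> complex \<Rightarrow> complex Matrix.mat" where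
  "mat22 a b c d \<equiv> mat_of_rows_list 2 [[a, b], [c, d]]"

definition Omega_block :: "imat \<Rightarrow> nat \<Rightarrow> nat \<Rightarrow> complex Matrix.mat" where
  "Omega_block \<Omega> Nt n = Matrix.mat Nt Nt (\<lambda>(j, i). \<Omega> (n + i) (n - Nt + j))"

end

theory Submission
  imports Defs
begin

text \<open>Let \<open>W(t)\<close> be the matrix with rows \<open>(Pe\<^sub>p(t), t Po\<^sub>p(t))\<close> and \<open>(Po\<^sub>p(t), Pe\<^sub>p(t))\<close>, where
  \<open>Pe\<^sub>p = p Pe\<close> and \<open>Po\<^sub>p = p Po\<close>, so that the row of perturbed weights times \<open>W\<close> is the row of
  original weights. Replacing \<open>W(x)\<close> by \<open>W(t)\<close> under the integral sign turns the row of
  perturbed second kind functions times \<open>W(x)\<close> into \<open>\<Omega> (C\<^sub>1, C\<^sub>2)\<close> plus integrals of difference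
  quotients, which yield the correction terms. In terms of moments, with \<open>\<Lambda>\<close> the shift matrix, the
  same equation reads \<open>g\<^sub>c P\<^sub>p(\<Lambda>)\<^sup>T = g\<close> for the perturbing polynomial \<open>P\<^sub>p(z) = Pe\<^sub>p(z\<^sup>2) + z Po\<^sub>p(z\<^sup>2)\<close>.
  By the two factorizations \<open>\<Omega>\<close> is therefore banded, and \<open>\<Omega>\<^sup>T\<close> maps the perturbed \<open>A\<close>-vectors to
  \<open>W(y)\<close> applied to the original ones. Moving \<open>\<Omega>\<close> from the second kind functions to the
  \<open>A\<close>-vectors in the kernel sum over \<open>l < n\<close> leaves only the boundary block \<open>\<Omega>[n]\<close>. Finally
  multiply by the adjugate of \<open>W(x)\<close> with the factor \<open>p(x)\<close> removed.\<close>

section \<open>Integration against weights with point masses\<close>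

text \<open>Finiteness of the mass set belongs to the notion because \<open>Sum_any\<close> returns
  0 on an infinite support, so that additivity of \<open>gint\<close> could fail.\<close>

definition gintegrable :: "real set \<Rightarrow> gweight \<Rightarrow> (complex \<Rightarrow> complex) \<Rightarrow> bool" where
  "gintegrable \<Delta> u f \<longleftrightarrow> finite {\<zeta>. point_masses u \<zeta> \<noteq> 0} \<and>
     set_integrable lborel \<Delta> (\<lambda>t. f (of_real t) * of_real (ac_density u t))"

text \<open>The support of the summand varies with \<open>f\<close>, while the set of masses does
  not. Sums for different test functions thus range over one common set.\<close>

lemma mass_sum_eq:
  assumes "finite {\<zeta>. m \<zeta> \<noteq> 0}"
  shows "Sum_any (\<lambda>\<zeta>. m \<zeta> * f \<zeta>) = (\<Sum>\<zeta> | m \<zeta> \<noteq> 0. m \<zeta> * f \<zeta> :: complex)"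
  by (rule Sum_any.expand_superset) (use assms in auto)

lemma gintegrable_add:
  assumes "gintegrable \<Delta> u f" "gintegrable \<Delta> u g"
  shows "gintegrable \<Delta> u (\<lambda>t. f t + g t)"
  using assms by (auto simp: gintegrable_def ring_distribs)

lemma gint_add:
  assumes "gintegrable \<Delta> u f" "gintegrable \<Delta> u g"
  shows "gint \<Delta> u (\<lambda>t. f t + g t) = gint \<Delta> u f + gint \<Delta> u g"
  using assms
  by (simp only: gintegrable_def gint_def mass_sum_eq) (simp add: ring_distribs sum.distrib)

lemma gintegrable_cmult:
  assumes "gintegrable \<Delta> u f"
  shows "gintegrable \<Delta> u (\<lambda>t. a * f t)"
  using assms by (auto simp: gintegrable_def mult.assoc)

lemma gint_cmult:
  assumes "gintegrable \<Delta> u f"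
  shows "gint \<Delta> u (\<lambda>t. a * f t) = a * gint \<Delta> u f"
  using assms
  by (simp only: gintegrable_def gint_def mass_sum_eq)
     (simp add: ring_distribs sum_distrib_left mult.assoc mult.left_commute[of _ a])

lemma gintegrable_zero:
  assumes "finite {\<zeta>. point_masses u \<zeta> \<noteq> 0}"
  shows "gintegrable \<Delta> u (\<lambda>t. 0)"
  using assms by (simp add: gintegrable_def set_integrable_def)

lemma gint_zero: "gint \<Delta> u (\<lambda>t. 0) = 0"
  by (simp add: gint_def set_lebesgue_integral_def)

lemma gintegrable_sum:
  assumes "finite {\<zeta>. point_masses u \<zeta> \<noteq> 0}" "\<And>i. i \<in> I \<Longrightarrow> gintegrable \<Delta> u (f i)"
  shows "gintegrable \<Delta> u (\<lambda>t. \<Sum>i\<in>I. f i t)"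
  using assms(2)
  by (induction I rule: infinite_finite_induct)
     (auto intro: gintegrable_add gintegrable_zero assms(1))

lemma gint_sum:
  assumes "finite {\<zeta>. point_masses u \<zeta> \<noteq> 0}" "\<And>i. i \<in> I \<Longrightarrow> gintegrable \<Delta> u (f i)"
  shows "gint \<Delta> u (\<lambda>t. \<Sum>i\<in>I. f i t) = (\<Sum>i\<in>I. gint \<Delta> u (f i))"
  using assms(2)
  by (induction I rule: infinite_finite_induct)
     (auto simp: gint_zero gint_add gintegrable_sum[OF assms(1)])

lemma gint_linear_combination:
  assumes "finite {\<zeta>. point_masses u \<zeta> \<noteq> 0}" "\<And>i. i \<in> I \<Longrightarrow> gintegrable \<Delta> u (f i)"
  shows "gint \<Delta> u (\<lambda>t. \<Sum>i\<in>I. a i * f i t) = (\<Sum>i\<in>I. a i * gint \<Delta> u (f i))"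
  using assms by (subst gint_sum) (auto intro: gintegrable_cmult simp: gint_cmult)

lemma gintegrable_poly:
  assumes "finite_moments \<Delta> u"
  shows "gintegrable \<Delta> u (poly F)"
proof -
  have fin: "finite {\<zeta>. point_masses u \<zeta> \<noteq> 0}"
    using assms by (simp add: finite_moments_def)
  have "gintegrable \<Delta> u (\<lambda>t. t ^ k)" for k
  proof -
    have "integrable lborel (\<lambda>t. complex_of_real (indicator \<Delta> t *\<^sub>R (t ^ k * ac_density u t)))"
      using assms
      by (intro integrable_of_real) (simp only: finite_moments_def set_integrable_def)
    then show ?thesis
      using fin by (simp add: gintegrable_def set_integrable_def scaleR_conv_of_real)
  qed
  then have "gintegrable \<Delta> u (\<lambda>t. \<Sum>k\<le>degree F. coeff F k * t ^ k)"
    by (intro gintegrable_sum fin gintegrable_cmult)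
  then show ?thesis
    by (simp add: poly_altdef[abs_def])
qed

text \<open>Induction on the power through t^(k+1) / (x - t) = x t^k / (x - t) - t^k. The case k = 0
  is the definition of \<open>cauchy_domain\<close>, and the subtracted term is a moment.\<close>

lemma gintegrable_poly_divide:
  assumes mom: "finite_moments \<Delta> (u b)" and b: "b \<in> {1, 2}" and x: "x \<in> cauchy_domain \<Delta> u"
  shows "gintegrable \<Delta> (u b) (\<lambda>t. poly F t / (x - t))"
proof -
  have fin: "finite {\<zeta>. point_masses (u b) \<zeta> \<noteq> 0}"
    using mom by (simp add: finite_moments_def)
  have "gintegrable \<Delta> (u b) (\<lambda>t. t ^ k / (x - t))" for k
  proof (induction k)
    case 0
    show ?case
      using x b fin by (auto simp: gintegrable_def cauchy_domain_def)
  next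
    case (Suc k)
    define v where "v t = indicator \<Delta> t *\<^sub>R complex_of_real (ac_density (u b) t)" for t
    have IH: "integrable lborel (\<lambda>t. of_real t ^ k / (x - of_real t) * v t)"
      using Suc by (simp add: gintegrable_def set_integrable_def v_def)
    have "gintegrable \<Delta> (u b) (poly (monom 1 k))"
      by (rule gintegrable_poly[OF mom])
    then have "integrable lborel (\<lambda>t. of_real t ^ k * v t)"
      by (simp add: gintegrable_def set_integrable_def v_def poly_monom)
    then have int: "integrable lborel
        (\<lambda>t. x * (of_real t ^ k / (x - of_real t) * v t) - of_real t ^ k * v t)"
      by (intro Bochner_Integration.integrable_diff integrable_mult_right[OF IH])
    have [measurable]: "(\<lambda>t. of_real t ^ k / (x - of_real t) * v t) \<in> borel_measurable lborel"
      using IH by measurable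
    \<comment> \<open>The point \<open>x\<close> may lie in \<Delta>. There division by zero returns
      0 and the recursion can fail, but a single point is a null set.\<close>
    have "AE t in lborel. complex_of_real t \<noteq> x"
    proof -
      have "AE t in lborel. t \<notin> {t. complex_of_real t = x}"
      proof (rule AE_not_in[OF finite_imp_null_set_lborel])
        have "{t. complex_of_real t = x} \<subseteq> {Re x}"
          by auto
        then show "finite {t. complex_of_real t = x}"
          by (rule finite_subset) simp
      qed
      then show ?thesis
        by simp
    qed
    then have "AE t in lborel. x * (of_real t ^ k / (x - of_real t) * v t) - of_real t ^ k * v t
        = of_real t * (of_real t ^ k / (x - of_real t) * v t)"
      by eventually_elim (auto simp: field_simps)
    moreover have "(\<lambda>t. of_real t * (of_real t ^ k / (x - of_real t) * v t)) \<in> borel_measurable lborel"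
      by measurable
    ultimately have "integrable lborel (\<lambda>t. of_real t * (of_real t ^ k / (x - of_real t) * v t))"
      by (intro integrable_cong_AE_imp[OF int])
    then show ?case
      using fin by (simp add: gintegrable_def set_integrable_def v_def mult.assoc mult.left_commute)
  qed
  then have "gintegrable \<Delta> (u b) (\<lambda>t. \<Sum>k\<le>degree F. coeff F k * (t ^ k / (x - t)))"
    by (intro gintegrable_sum fin gintegrable_cmult)
  then show ?thesis
    by (simp add: poly_altdef[abs_def] sum_divide_distrib)
qed

lemma cpoly_of_real: "cpoly R (of_real t) = of_real (poly R t)"
  by (induction R) (auto simp: map_poly_pCons)

lemma cpoly_arith:
  "cpoly (p * q) z = cpoly p z * cpoly q z"
  "cpoly (p - q) z = cpoly p z - cpoly q z"
proof -
  have "map_poly complex_of_real (p * q) = map_poly of_real p * map_poly of_real q"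
    by (rule poly_eqI) (simp add: coeff_map_poly coeff_mult)
  then show "cpoly (p * q) z = cpoly p z * cpoly q z"
    by simp
  have "map_poly complex_of_real (p - q) = map_poly of_real p - map_poly of_real q"
    by (rule poly_eqI) (simp add: coeff_map_poly)
  then show "cpoly (p - q) z = cpoly p z - cpoly q z"
    by simp
qed

text \<open>Densities are compared almost everywhere on \<Delta>, masses pointwise. Integrability is
  assumed instead of derived because \<open>f\<close> will be a Cauchy integrand with a pole at
  \<open>x\<close>.\<close>

lemma gint_poly_combination:
  assumes eq: "gw_eq_on \<Delta> (gw_add (gw_poly_mult R1 u1) (gw_poly_mult R2 u2)) v"
    and v: "gintegrable \<Delta> v f"
    and 1: "gintegrable \<Delta> u1 (\<lambda>t. cpoly R1 t * f t)"
    and 2: "gintegrable \<Delta> u2 (\<lambda>t. cpoly R2 t * f t)"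
  shows "gint \<Delta> v f = gint \<Delta> u1 (\<lambda>t. cpoly R1 t * f t) + gint \<Delta> u2 (\<lambda>t. cpoly R2 t * f t)"
proof -
  have ae: "AE t in lborel. t \<in> \<Delta> \<longrightarrow>
      poly R1 t * ac_density u1 t + poly R2 t * ac_density u2 t = ac_density v t"
    using eq by (simp add: gw_eq_on_def gw_add_def gw_poly_mult_def)
  have masses: "point_masses v = (\<lambda>\<zeta>. cpoly R1 \<zeta> * point_masses u1 \<zeta> + cpoly R2 \<zeta> * point_masses u2 \<zeta>)"
    using eq by (simp add: gw_eq_on_def gw_add_def gw_poly_mult_def)
  \<comment> \<open>By \<open>masses\<close>, a point outside both mass sets carries no mass of
    \<open>v\<close> either, so all three sums can be taken over \<open>M\<close>.\<close>
  define M where "M = {\<zeta>. point_masses u1 \<zeta> \<noteq> 0} \<union> {\<zeta>. point_masses u2 \<zeta> \<noteq> 0}"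
  have M: "finite M"
    using 1 2 by (simp add: M_def gintegrable_def)
  have ex: "Sum_any g = sum g M" if "\<And>\<zeta>. \<zeta> \<notin> M \<Longrightarrow> g \<zeta> = 0" for g :: "complex \<Rightarrow> complex"
    using that by (intro Sum_any.expand_superset M) auto
  have "Sum_any (\<lambda>\<zeta>. point_masses v \<zeta> * f \<zeta>)
      = Sum_any (\<lambda>\<zeta>. point_masses u1 \<zeta> * (cpoly R1 \<zeta> * f \<zeta>))
        + Sum_any (\<lambda>\<zeta>. point_masses u2 \<zeta> * (cpoly R2 \<zeta> * f \<zeta>))"
    by (subst (1 2 3) ex) (auto simp: M_def masses sum.distrib[symmetric] algebra_simps intro!: sum.cong)
  moreover have "(LINT t:\<Delta>|lborel. f (of_real t) * of_real (ac_density v t))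
      = (LINT t:\<Delta>|lborel. cpoly R1 (of_real t) * f (of_real t) * of_real (ac_density u1 t)
          + cpoly R2 (of_real t) * f (of_real t) * of_real (ac_density u2 t))"
    unfolding set_lebesgue_integral_def
  proof (rule integral_cong_AE)
    show "(\<lambda>t. indicator \<Delta> t *\<^sub>R (f (of_real t) * of_real (ac_density v t))) \<in> borel_measurable lborel"
      using v by (auto simp: gintegrable_def set_integrable_def)
    show "(\<lambda>t. indicator \<Delta> t *\<^sub>R (cpoly R1 (of_real t) * f (of_real t) * of_real (ac_density u1 t)
          + cpoly R2 (of_real t) * f (of_real t) * of_real (ac_density u2 t))) \<in> borel_measurable lborel"
      unfolding scaleR_add_right
      using 1 2 by (intro borel_measurable_add) (auto simp: gintegrable_def set_integrable_def)
    show "AE t in lborel. indicator \<Delta> t *\<^sub>R (f (of_real t) * of_real (ac_density v t))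
        = indicator \<Delta> t *\<^sub>R (cpoly R1 (of_real t) * f (of_real t) * of_real (ac_density u1 t)
          + cpoly R2 (of_real t) * f (of_real t) * of_real (ac_density u2 t))"
      using ae
    proof eventually_elim
      case (elim t)
      show ?case
      proof (cases "t \<in> \<Delta>")
        case True
        then have "complex_of_real (ac_density v t)
            = of_real (poly R1 t) * of_real (ac_density u1 t) + of_real (poly R2 t) * of_real (ac_density u2 t)"
          using elim by (simp flip: of_real_mult of_real_add)
        then show ?thesis
          by (simp add: cpoly_of_real algebra_simps)
      qed simp
    qed
  qed
  ultimately show ?thesis
    using 1 2 unfolding gint_def gintegrable_def by (simp add: set_integral_add)
qed

section \<open>The connection matrix\<close>

lemma imat_inv:
  assumes "lower_tri A" "\<And>i. A i i \<noteq> 0"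
  shows "lower_tri (imat_inv A)" "A \<star> imat_inv A = imat_one" "imat_inv A \<star> A = imat_one"
  using theI'[OF ex1_imat_inv[OF assms]] by (auto simp: imat_inv_def)

lemma imat_inv_unitri:
  assumes "lower_unitri A"
  shows "lower_tri (imat_inv A)" "A \<star> imat_inv A = imat_one" "imat_inv A \<star> A = imat_one"
  using assms by (auto simp: lower_unitri_def intro!: imat_inv)

lemma nonsing_diag_lower_tri: "nonsing_diag H \<Longrightarrow> lower_tri H"
  by (auto simp: nonsing_diag_def lower_tri_def)

lemma nonsing_diag_mult:
  assumes "nonsing_diag H"
  shows "(H \<star> A) i j = H i i * A i j"
proof -
  have "(H \<star> A) i j = (\<Sum>k\<le>i. H i k * A k j)"
    by (rule imat_mult_lower[OF nonsing_diag_lower_tri[OF assms]])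
  also have "\<dots> = (\<Sum>k\<in>{i}. H i k * A k j)"
    using assms by (intro sum.mono_neutral_right) (auto simp: nonsing_diag_def)
  finally show ?thesis
    by simp
qed

lemma imat_inv_diag:
  assumes "nonsing_diag H"
  shows "nonsing_diag (imat_inv H)" "imat_inv H i i = 1 / H i i"
proof -
  have nz: "H i i \<noteq> 0" for i
    using assms by (simp add: nonsing_diag_def)
  have "imat_one i j = H i i * imat_inv H i j" for i j
    using imat_inv(2)[OF nonsing_diag_lower_tri[OF assms] nz] nonsing_diag_mult[OF assms] by metis
  then have "imat_inv H i j = imat_one i j / H i i" for i j
    using nz by (simp add: field_simps)
  then show "nonsing_diag (imat_inv H)" "imat_inv H i i = 1 / H i i"
    using nz by (auto simp: nonsing_diag_def imat_one_def)
qed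

text \<open>A vector is read as a matrix whose columns all equal it, so the laws for matrix products
  carry over to vectors; the column index is arbitrary.\<close>

lemma imat_vec_eq_mult: "(A \<star>\<^sub>v v) i = (A \<star> (\<lambda>k j. v k)) i j"
  by (simp add: imat_vec_def imat_mult_def)

lemma imat_vec_lower:
  assumes "lower_tri A"
  shows "(A \<star>\<^sub>v v) i = (\<Sum>k\<le>i. A i k * v k)"
  unfolding imat_vec_eq_mult[of _ _ _ 0] by (rule imat_mult_lower[OF assms])

lemma imat_vec_assoc:
  assumes "lower_tri A" "lower_tri B"
  shows "(A \<star> B) \<star>\<^sub>v v = A \<star>\<^sub>v B \<star>\<^sub>v v"
  unfolding fun_eq_iff imat_vec_eq_mult[of _ _ _ 0] imat_mult_assoc[OF assms]
  by (simp add: imat_mult_def)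

lemma imat_one_vec: "imat_one \<star>\<^sub>v v = v"
  unfolding fun_eq_iff imat_vec_eq_mult[of _ _ _ 0] imat_one_mult by simp

lemma nonsing_diag_vec:
  assumes "nonsing_diag H"
  shows "(H \<star>\<^sub>v v) i = H i i * v i"
  unfolding imat_vec_eq_mult[of _ _ _ 0] by (rule nonsing_diag_mult[OF assms])

text \<open>Multiplication by \<open>S\<close> cancels the left factor. The upper triangular factor
  stays rightmost, so associativity for lower triangular left factors suffices.\<close>

lemma LDU_left:
  assumes "LDU_factorization g S H S'"
  shows "(S \<star> g) l j = H l l * imat_inv S' j l"
proof -
  have S: "lower_unitri S" and H: "nonsing_diag H"
    and g: "g = imat_inv S \<star> H \<star> imat_transpose (imat_inv S')"
    using assms by (auto simp: LDU_factorization_def)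
  have "S \<star> g = H \<star> imat_transpose (imat_inv S')"
    using S unfolding g
    by (subst imat_mult_assoc[symmetric])
       (auto simp: imat_inv_unitri imat_one_mult lower_unitri_def[of S])
  then show ?thesis
    by (simp add: nonsing_diag_mult[OF H] imat_transpose_def)
qed

text \<open>With the shift matrix \<Lambda>, \<open>g_shift\<close> says g = gc q(\<Lambda>)^T. The
  entrywise form avoids a product with the full matrix \<open>gc\<close> on the left, to which the
  associativity law does not apply. The weights enter only through this relation.\<close>

locale shifted_moments =
  fixes g S H St gc Sc Hc Stc :: imat and q :: ivec and d :: nat
  assumes LDU: "LDU_factorization g S H St"
    and LDUc: "LDU_factorization gc Sc Hc Stc"
    and g_shift: "g i j = (\<Sum>m\<le>d. q m * gc i (j + m))"
begin

definition Omega :: imat where "Omega = Sc \<star> imat_inv S"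

lemma unitri: "lower_unitri S" "lower_unitri St" "lower_unitri Sc" "lower_unitri Stc"
  and diag: "nonsing_diag H" "nonsing_diag Hc"
  using LDU LDUc by (auto simp: LDU_factorization_def)

lemma lower: "lower_tri S" "lower_tri St" "lower_tri Sc" "lower_tri Stc"
  using unitri by (auto simp: lower_unitri_def)

lemma lower_Omega: "lower_tri Omega"
  unfolding Omega_def by (intro lower_tri_mult lower imat_inv_unitri unitri)

lemma Omega_mult_S: "Omega \<star> S = Sc"
  unfolding Omega_def
  by (simp add: imat_mult_assoc lower imat_inv_unitri unitri imat_mult_one)

text \<open>Both factorizations are inserted into Omega S g = Sc gc q(\<Lambda>)^T. The result, in
  entries, is Omega H = Hc (St q(\<Lambda>) Stc^-1)^T.\<close>

lemma Omega_diag_eq: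
  "Omega l k * H k k = Hc l l * (\<Sum>j\<le>k. St k j * (\<Sum>m\<le>d. q m * imat_inv Stc (j + m) l))"
proof -
  \<comment> \<open>This is Omega H St^-T = Hc Stc^-T q(\<Lambda>)^T; it remains to multiply by St^T
    from the right.\<close>
  have row: "(\<Sum>k\<le>l. Omega l k * (H k k * imat_inv St j k))
      = Hc l l * (\<Sum>m\<le>d. q m * imat_inv Stc (j + m) l)" for j
  proof -
    have "(\<Sum>k\<le>l. Omega l k * (H k k * imat_inv St j k)) = (Omega \<star> (S \<star> g)) l j"
      by (simp add: imat_mult_lower[OF lower_Omega] LDU_left[OF LDU])
    also have "\<dots> = (Sc \<star> g) l j"
      by (simp add: imat_mult_assoc[symmetric] lower_Omega lower Omega_mult_S)
    also have "\<dots> = (\<Sum>i\<le>l. \<Sum>m\<le>d. q m * (Sc l i * gc i (j + m)))"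
      by (simp add: imat_mult_lower lower g_shift sum_distrib_left mult.left_commute)
    also have "\<dots> = (\<Sum>m\<le>d. q m * (Sc \<star> gc) l (j + m))"
      by (subst sum.swap) (simp add: imat_mult_lower lower sum_distrib_left)
    finally show ?thesis
      by (simp add: LDU_left[OF LDUc] sum_distrib_left mult.left_commute)
  qed
  have "Hc l l * (\<Sum>j\<le>k. St k j * (\<Sum>m\<le>d. q m * imat_inv Stc (j + m) l))
      = (\<Sum>j\<le>k. St k j * (\<Sum>i\<le>l. Omega l i * (H i i * imat_inv St j i)))"
    by (simp only: row) (simp add: sum_distrib_left mult.left_commute)
  also have "\<dots> = (\<Sum>i\<le>l. Omega l i * H i i * (St \<star> imat_inv St) k i)"
    unfolding imat_mult_lower[OF lower(2)] sum_distrib_left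
    by (subst sum.swap) (simp add: mult_ac)
  also have "\<dots> = (\<Sum>i\<le>l. if i = k then Omega l i * H i i else 0)"
    by (intro sum.cong) (auto simp: imat_inv_unitri unitri imat_one_def)
  also have "\<dots> = Omega l k * H k k"
    using lower_Omega by (auto simp: lower_tri_def)
  finally show ?thesis ..
qed

text \<open>In \<open>Omega_diag_eq\<close> only rows j + m \<le> k + d of the inverse of
  \<open>Stc\<close> occur, and a lower triangular matrix vanishes there in column l > k +
  d.\<close>

lemma Omega_banded:
  assumes "k + d < l"
  shows "Omega l k = 0"
proof -
  have "(\<Sum>j\<le>k. St k j * (\<Sum>m\<le>d. q m * imat_inv Stc (j + m) l)) = 0"
    using assms imat_inv_unitri(1)[OF unitri(4)]
    by (intro sum.neutral ballI mult_zero_right[THEN trans[rotated]] arg_cong2[where f = "(*)"] refl)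
       (auto simp: lower_tri_def)
  then show ?thesis
    using Omega_diag_eq[of l k] diag(1) by (auto simp: nonsing_diag_def)
qed

text \<open>After solving \<open>Omega_diag_eq\<close> for \<open>Omega\<close>, the factor
  \<open>Hc\<close> cancels against its inverse and \<open>Stc^-1\<close> against
  \<open>Stc\<close>, which leaves H^-1 St q(\<Lambda>) v. Bandedness is why the column sum can stop
  at k + d.\<close>

lemma Omega_transpose_vec:
  "(\<Sum>l\<le>k + d. Omega l k * (imat_inv Hc \<star>\<^sub>v Stc \<star>\<^sub>v v) l)
     = (imat_inv H \<star>\<^sub>v St \<star>\<^sub>v (\<lambda>j. \<Sum>m\<le>d. q m * v (j + m))) k"
proof -
  have nz: "H i i \<noteq> 0" "Hc i i \<noteq> 0" for i
    using diag by (auto simp: nonsing_diag_def)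
  \<comment> \<open>Rows of index at most k + d of the inverse have no entries beyond column k + d,
    so the truncated sum is the full product.\<close>
  have recover: "(\<Sum>l\<le>k + d. imat_inv Stc i l * (Stc \<star>\<^sub>v v) l) = v i" if "i \<le> k + d" for i
  proof -
    have "(\<Sum>l\<le>k + d. imat_inv Stc i l * (Stc \<star>\<^sub>v v) l) = (\<Sum>l\<le>i. imat_inv Stc i l * (Stc \<star>\<^sub>v v) l)"
      using that imat_inv_unitri(1)[OF unitri(4)]
      by (intro sum.mono_neutral_right) (auto simp: lower_tri_def)
    also have "\<dots> = (imat_inv Stc \<star>\<^sub>v Stc \<star>\<^sub>v v) i"
      by (simp add: imat_vec_lower imat_inv_unitri unitri)
    also have "\<dots> = v i"
      by (simp add: imat_vec_assoc[symmetric] imat_inv_unitri unitri lower imat_one_vec)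
    finally show ?thesis .
  qed
  have entry: "Omega l k * (imat_inv Hc \<star>\<^sub>v Stc \<star>\<^sub>v v) l
      = (\<Sum>j\<le>k. \<Sum>m\<le>d. St k j * q m * (imat_inv Stc (j + m) l * (Stc \<star>\<^sub>v v) l)) / H k k" for l
  proof -
    have "Omega l k = Hc l l * (\<Sum>j\<le>k. St k j * (\<Sum>m\<le>d. q m * imat_inv Stc (j + m) l)) / H k k"
      using Omega_diag_eq[of l k] nz by (simp add: field_simps)
    then show ?thesis
      using nz
      by (simp add: nonsing_diag_vec imat_inv_diag diag sum_distrib_left sum_distrib_right mult_ac)
  qed
  have "(\<Sum>l\<le>k + d. Omega l k * (imat_inv Hc \<star>\<^sub>v Stc \<star>\<^sub>v v) l)
      = (\<Sum>j\<le>k. \<Sum>m\<le>d. St k j * q m * (\<Sum>l\<le>k + d. imat_inv Stc (j + m) l * (Stc \<star>\<^sub>v v) l)) / H k k"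
    unfolding entry sum_divide_distrib[symmetric] sum_distrib_left
    by (subst sum.swap, subst (2) sum.swap) (rule refl)
  also have "\<dots> = (\<Sum>j\<le>k. St k j * (\<Sum>m\<le>d. q m * v (j + m))) / H k k"
    by (simp add: recover sum_distrib_left mult.assoc)
  also have "\<dots> = (imat_inv H \<star>\<^sub>v St \<star>\<^sub>v (\<lambda>j. \<Sum>m\<le>d. q m * v (j + m))) k"
    by (simp add: nonsing_diag_vec imat_inv_diag diag imat_vec_lower lower)
  finally show ?thesis .
qed

end

text \<open>The left side uses the entries of \<open>W\<close> in the n by n corner, whereas the
  full columns k < n reach down to row n + d - 1. The excess rows n + i meet the band only in the
  last d columns, and this corner block is subtracted.\<close>

lemma banded_partial_sum:
  fixes W :: imat
  assumes lower: "lower_tri W" and banded: "\<And>l k. k + d < l \<Longrightarrow> W l k = 0" and n: "d \<le> n"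
  shows "(\<Sum>l<n. (\<Sum>k\<le>l. W l k * C k) * A l)
    = (\<Sum>k<n. C k * (\<Sum>l\<le>k + d. W l k * A l))
      - (\<Sum>j<d. (\<Sum>i<d. A (n + i) * W (n + i) (n - d + j)) * C (n - d + j))"
proof -
  define f where "f l k = C k * (W l k * A l)" for l k
  have split: "(\<Sum>l<n + d. h l) = (\<Sum>l<n. h l) + (\<Sum>i<d. h (n + i))" for h :: ivec
    by (induction d) (simp_all add: add.assoc)
  have "(\<Sum>k<n. C k * (\<Sum>l\<le>k + d. W l k * A l)) = (\<Sum>k<n. \<Sum>l<n + d. f l k)"
    unfolding f_def sum_distrib_left
    by (intro sum.cong sum.mono_neutral_left) (auto simp: banded not_le)
  also have "\<dots> = (\<Sum>k<n. (\<Sum>l<n. f l k) + (\<Sum>i<d. f (n + i) k))"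
    by (simp only: split)
  also have "\<dots> = (\<Sum>k<n. \<Sum>l<n. f l k) + (\<Sum>k<n. \<Sum>i<d. f (n + i) k)"
    by (rule sum.distrib)
  also have "(\<Sum>k<n. \<Sum>l<n. f l k) = (\<Sum>l<n. \<Sum>k<n. f l k)"
    by (rule sum.swap)
  also have "(\<Sum>l<n. \<Sum>k<n. f l k) = (\<Sum>l<n. (\<Sum>k\<le>l. W l k * C k) * A l)"
    unfolding f_def sum_distrib_right using lower
    by (intro sum.cong sum.mono_neutral_cong_right) (auto simp: lower_tri_def)
  \<comment> \<open>A column k < n - d has k + d < n + i, hence lies outside the band.\<close>
  also have "(\<Sum>k<n. \<Sum>i<d. f (n + i) k) = (\<Sum>k\<in>{n - d..<n}. \<Sum>i<d. f (n + i) k)"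
    by (intro sum.mono_neutral_right) (auto simp: f_def intro!: sum.neutral banded)
  also have "\<dots> = (\<Sum>j<d. \<Sum>i<d. f (n + i) (n - d + j))"
    using n sum.shift_bounds_nat_ivl[of "\<lambda>k. \<Sum>i<d. f (n + i) k" 0 "n - d" d]
    by (simp add: lessThan_atLeast0 add.commute)
  finally show ?thesis
    by (simp add: f_def sum_distrib_left sum_distrib_right mult_ac)
qed

section \<open>Shifting the monomial vectors\<close>

abbreviation even_odd_poly :: "real poly \<Rightarrow> real poly \<Rightarrow> real poly" where
  "even_odd_poly E F \<equiv> pcompose E [:0, 0, 1:] + [:0, 1:] * pcompose F [:0, 0, 1:]"

lemma coeff_pcompose_square:
  fixes E :: "real poly"
  shows "coeff (pcompose E [:0, 0, 1:]) m = (if even m then coeff E (m div 2) else 0)"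
proof (induction E arbitrary: m)
  case (pCons a E)
  show ?case
  proof (cases m)
    case (Suc k)
    then show ?thesis
      using pCons by (cases k) (simp_all add: pcompose_pCons)
  qed (simp add: pcompose_pCons)
qed simp

lemma coeff_even_odd_poly:
  "coeff (even_odd_poly E F) m = (if even m then coeff E (m div 2) else coeff F (m div 2))"
  by (cases m) (auto simp: coeff_pcompose_square poly_0_coeff_0)

lemma sum_even_odd:
  fixes f :: "nat \<Rightarrow> 'a::comm_monoid_add"
  shows "(\<Sum>m<2 * K. f m) = (\<Sum>i<K. f (2 * i) + f (2 * i + 1))"
  by (induction K) (simp_all add: add.assoc)

lemma cpoly_eq_sum:
  assumes "\<And>i. i \<ge> K \<Longrightarrow> coeff R i = 0"
  shows "cpoly R z = (\<Sum>i<K. of_real (coeff R i) * z ^ i)"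
proof -
  have "cpoly R z = (\<Sum>i\<le>degree R. of_real (coeff R i) * z ^ i)"
    by (simp add: poly_altdef coeff_map_poly degree_map_poly)
  also have "\<dots> = (\<Sum>i<K. of_real (coeff R i) * z ^ i)"
    using assms by (intro sum.mono_neutral_cong) (auto simp: coeff_eq_0 not_le not_less)
  finally show ?thesis .
qed

text \<open>The shift interchanges the two monomial vectors, up to a factor y in one direction, and
  its square acts as multiplication by y.\<close>

lemma Xvec_part_shift:
  "Xvec_part a y (j + 2 * i) = y ^ i * Xvec_part a y j"
  "Xvec_part 1 y (Suc (j + 2 * i)) = y ^ i * (y * Xvec_part 2 y j)"
  "Xvec_part 2 y (Suc (j + 2 * i)) = y ^ i * Xvec_part 1 y j"
  by (auto simp: Xvec_part_def power_add elim!: evenE oddE)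

text \<open>Even powers of the shift preserve the part and add up to E(y), odd powers swap the parts
  and add up to F(y). The coefficients on the right are the two rows of W(y).\<close>

lemma Xvec_part_poly_shift:
  assumes "degree (even_odd_poly E F) \<le> d"
  shows "(\<Sum>m\<le>d. of_real (coeff (even_odd_poly E F) m) * Xvec_part 1 y (j + m))
      = cpoly E y * Xvec_part 1 y j + y * cpoly F y * Xvec_part 2 y j" (is "?L 1 = _")
    and "(\<Sum>m\<le>d. of_real (coeff (even_odd_poly E F) m) * Xvec_part 2 y (j + m))
      = cpoly F y * Xvec_part 1 y j + cpoly E y * Xvec_part 2 y j"
proof -
  define q where "q = coeff (even_odd_poly E F)"
  have q: "q m = (if even m then coeff E (m div 2) else coeff F (m div 2))" for m
    unfolding q_def by (rule coeff_even_odd_poly)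
  have zero: "q m = 0" if "m > d" for m
    unfolding q_def using that assms by (intro coeff_eq_0) (rule le_less_trans)
  have E: "coeff E i = 0" if "i \<ge> Suc d" for i
    using zero[of "2 * i"] that by (simp add: q)
  have F: "coeff F i = 0" if "i \<ge> Suc d" for i
    using zero[of "2 * i + 1"] that by (simp add: q)
  have cE: "cpoly E y = (\<Sum>i<Suc d. of_real (coeff E i) * y ^ i)"
    by (rule cpoly_eq_sum) (rule E)
  have cF: "cpoly F y = (\<Sum>i<Suc d. of_real (coeff F i) * y ^ i)"
    by (rule cpoly_eq_sum) (rule F)
  have L: "?L a = (\<Sum>i<Suc d. of_real (coeff E i) * Xvec_part a y (j + 2 * i)
      + of_real (coeff F i) * Xvec_part a y (Suc (j + 2 * i)))" for a
  proof -
    \<comment> \<open>Zero coefficients extend the range to an even number of terms, which then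
      split into pairs of an even and an odd index.\<close>
    have "?L a = (\<Sum>m<2 * Suc d. of_real (q m) * Xvec_part a y (j + m))"
      unfolding q_def[symmetric] by (intro sum.mono_neutral_left) (auto simp: zero not_le)
    then show ?thesis
      unfolding sum_even_odd by (simp add: q)
  qed
  show "?L 1 = cpoly E y * Xvec_part 1 y j + y * cpoly F y * Xvec_part 2 y j"
    unfolding L cE cF Xvec_part_shift
    by (simp only: sum.distrib sum_distrib_left sum_distrib_right mult_ac)
  show "?L 2 = cpoly F y * Xvec_part 1 y j + cpoly E y * Xvec_part 2 y j"
    unfolding L cE cF Xvec_part_shift
    by (simp only: sum.distrib sum_distrib_left sum_distrib_right mult_ac add.commute)
qed

section \<open>Moments and Cauchy integrals of the perturbed weights\<close>

text \<open>Membership in \<open>range poly\<close> expresses that a test function is polynomial, so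
  integrability reduces to these closure rules.\<close>

lemma range_poly_intros:
  fixes f g :: "complex \<Rightarrow> complex"
  shows "f \<in> range poly \<Longrightarrow> g \<in> range poly \<Longrightarrow> (\<lambda>t. f t + g t) \<in> range poly"
    and "f \<in> range poly \<Longrightarrow> g \<in> range poly \<Longrightarrow> (\<lambda>t. f t - g t) \<in> range poly"
    and "f \<in> range poly \<Longrightarrow> g \<in> range poly \<Longrightarrow> (\<lambda>t. f t * g t) \<in> range poly"
    and "cpoly R \<in> range poly"
    and "(\<lambda>t. a :: complex) \<in> range poly"
    and "(\<lambda>t. Xvec t i) \<in> range poly"
    and "(\<lambda>t. Xvec_part b t i) \<in> range poly"
proof -
  show "(\<lambda>t. f t + g t) \<in> range poly" if "f \<in> range poly" "g \<in> range poly"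
    using that by (auto simp flip: poly_add)
  show "(\<lambda>t. f t - g t) \<in> range poly" if "f \<in> range poly" "g \<in> range poly"
    using that by (auto simp flip: poly_diff)
  show "(\<lambda>t. f t * g t) \<in> range poly" if "f \<in> range poly" "g \<in> range poly"
    using that by (auto simp flip: poly_mult)
  show "cpoly R \<in> range poly"
    by simp
  show "(\<lambda>t. a :: complex) \<in> range poly"
    by (rule range_eqI[of _ _ "[:a:]"]) auto
  have mon: "(\<lambda>t::complex. t ^ k) \<in> range poly" for k
    by (rule range_eqI[of _ _ "monom 1 k"]) (simp add: fun_eq_iff poly_monom)
  show "(\<lambda>t. Xvec t i) \<in> range poly"
    by (simp add: Xvec_def mon)
  have zero: "(\<lambda>t::complex. 0::complex) \<in> range poly"
    by (rule range_eqI[of _ _ 0]) auto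
  show "(\<lambda>t. Xvec_part b t i) \<in> range poly"
    using mon[of "i div 2"] zero by (cases "if b = 1 then even i else odd i") (simp_all add: Xvec_part_def)
qed

lemma range_poly_sum:
  assumes "\<And>i. i \<in> I \<Longrightarrow> f i \<in> range poly"
  shows "(\<lambda>t::complex. \<Sum>i\<in>I. f i t) \<in> range poly"
  using assms by (induction I rule: infinite_finite_induct) (auto intro: range_poly_intros(1,5))

lemma Bpol_eq_sum:
  assumes "lower_tri S"
  shows "Bpol S t l = (\<Sum>k\<le>l. S l k * Xvec t k)"
  by (simp add: Bpol_def imat_vec_lower assms)

lemma Bpol_range_poly:
  assumes "lower_tri S"
  shows "(\<lambda>t. Bpol S t l) \<in> range poly"
  unfolding Bpol_eq_sum[OF assms] by (intro range_poly_sum range_poly_intros)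

lemma gintegrable_range_poly:
  assumes "finite_moments \<Delta> u" "f \<in> range poly"
  shows "gintegrable \<Delta> u f"
  using assms gintegrable_poly by auto

lemma gintegrable_range_poly_divide:
  assumes "finite_moments \<Delta> (u b)" "b \<in> {1, 2}" "x \<in> cauchy_domain \<Delta> u" "f \<in> range poly"
  shows "gintegrable \<Delta> (u b) (\<lambda>t. f t / (x - t))"
  using assms gintegrable_poly_divide by auto

text \<open>Shifting the column index multiplies the monomial vectors by W(t), and W(t) carries the
  perturbed weights to the original ones. This supplies \<open>g_shift\<close> for the moment
  matrices.\<close>

lemma moment_matrix_shift:
  assumes mom: "\<And>a. a \<in> {1, 2} \<Longrightarrow> finite_moments \<Delta> (u a)"
    and momc: "\<And>a. a \<in> {1, 2} \<Longrightarrow> finite_moments \<Delta> (uc a)"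
    and eq1: "gw_eq_on \<Delta> (gw_add (gw_poly_mult E (uc 1)) (gw_poly_mult F (uc 2))) (u 1)"
    and eq2: "gw_eq_on \<Delta> (gw_add (gw_poly_mult ([:0, 1:] * F) (uc 1)) (gw_poly_mult E (uc 2))) (u 2)"
    and deg: "degree (even_odd_poly E F) \<le> d"
  shows "moment_matrix \<Delta> u i j
    = (\<Sum>m\<le>d. of_real (coeff (even_odd_poly E F) m) * moment_matrix \<Delta> uc i (j + m))"
proof -
  define q :: ivec where "q m = of_real (coeff (even_odd_poly E F) m)" for m
  have fin: "finite {\<zeta>. point_masses (uc a) \<zeta> \<noteq> 0}" if "a \<in> {1, 2}" for a
    using momc[OF that] by (simp add: finite_moments_def)
  have I: "gintegrable \<Delta> (u a) f" if "a \<in> {1, 2}" "f \<in> range poly" for a f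
    using that mom by (intro gintegrable_range_poly)
  have Ic: "gintegrable \<Delta> (uc a) f" if "a \<in> {1, 2}" "f \<in> range poly" for a f
    using that momc by (intro gintegrable_range_poly)
  have comb: "(\<Sum>m\<le>d. q m * gint \<Delta> (uc a) (\<lambda>t. Xvec t i * Xvec_part b t (j + m)))
      = gint \<Delta> (uc a) (\<lambda>t. Xvec t i * (\<Sum>m\<le>d. q m * Xvec_part b t (j + m)))" if "a \<in> {1, 2}" for a b
  proof -
    have "gint \<Delta> (uc a) (\<lambda>t. \<Sum>m\<le>d. q m * (Xvec t i * Xvec_part b t (j + m)))
        = (\<Sum>m\<le>d. q m * gint \<Delta> (uc a) (\<lambda>t. Xvec t i * Xvec_part b t (j + m)))"
      by (intro gint_linear_combination fin Ic that range_poly_intros)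
    then show ?thesis
      by (simp add: sum_distrib_left mult.left_commute)
  qed
  define f where "f b = (\<lambda>t. Xvec t i * Xvec_part b t j)" for b
  have f: "f b \<in> range poly" and Rf: "(\<lambda>t. cpoly R t * f b t) \<in> range poly" for b R
    unfolding f_def by (intro range_poly_intros)+
  have one: "1 \<in> {1, 2 :: nat}" and two: "2 \<in> {1, 2 :: nat}"
    by simp_all
  have XF: "cpoly ([:0, 1:] * F) t = t * cpoly F t" for t
    by (simp add: map_poly_pCons)
  have "(\<Sum>m\<le>d. q m * moment_matrix \<Delta> uc i (j + m))
      = (\<Sum>m\<le>d. q m * gint \<Delta> (uc 1) (\<lambda>t. Xvec t i * Xvec_part 1 t (j + m)))
      + (\<Sum>m\<le>d. q m * gint \<Delta> (uc 2) (\<lambda>t. Xvec t i * Xvec_part 2 t (j + m)))"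
    unfolding moment_matrix_def distrib_left by (rule sum.distrib)
  also have "\<dots> = gint \<Delta> (uc 1) (\<lambda>t. cpoly E t * f 1 t + cpoly ([:0, 1:] * F) t * f 2 t)
      + gint \<Delta> (uc 2) (\<lambda>t. cpoly F t * f 1 t + cpoly E t * f 2 t)"
    unfolding comb[OF one] comb[OF two] unfolding q_def Xvec_part_poly_shift[OF deg] XF f_def
    by (simp only: distrib_left mult_ac)
  \<comment> \<open>The terms with \<open>f 1\<close> combine by the first column of the defining
    equation, those with \<open>f 2\<close> by the second.\<close>
  also have "\<dots> = gint \<Delta> (u 1) (f 1) + gint \<Delta> (u 2) (f 2)"
    unfolding gint_add[OF Ic[OF one Rf] Ic[OF one Rf]] gint_add[OF Ic[OF two Rf] Ic[OF two Rf]]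
      gint_poly_combination[OF eq1 I[OF one f] Ic[OF one Rf] Ic[OF two Rf]]
      gint_poly_combination[OF eq2 I[OF two f] Ic[OF one Rf] Ic[OF two Rf]]
    by (simp only: ac_simps)
  finally show ?thesis
    by (simp only: q_def moment_matrix_def f_def)
qed

text \<open>Writing \<open>R(t) = R(x) - (R(x) - R(t))\<close> under the integral sign splits off the
  second kind functions of the perturbed weights; the difference quotients form the
  correction term.\<close>

lemma gint_Cauchy_combination:
  assumes momc: "finite_moments \<Delta> (uc 1)" "finite_moments \<Delta> (uc 2)"
    and eq: "gw_eq_on \<Delta> (gw_add (gw_poly_mult R1 (uc 1)) (gw_poly_mult R2 (uc 2))) v"
    and v: "gintegrable \<Delta> v (\<lambda>t. B t / (x - t))"
    and x: "x \<in> cauchy_domain \<Delta> uc" and B: "B \<in> range poly"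
  shows "cpoly R1 x * gint \<Delta> (uc 1) (\<lambda>t. B t / (x - t)) + cpoly R2 x * gint \<Delta> (uc 2) (\<lambda>t. B t / (x - t))
    = gint \<Delta> v (\<lambda>t. B t / (x - t))
      + gint \<Delta> (uc 1) (\<lambda>t. B t * ((cpoly R1 x - cpoly R1 t) / (x - t)))
      + gint \<Delta> (uc 2) (\<lambda>t. B t * ((cpoly R2 x - cpoly R2 t) / (x - t)))"
proof -
  have I: "gintegrable \<Delta> (uc b) (\<lambda>t. cpoly R t * (B t / (x - t)))"
    "gintegrable \<Delta> (uc b) (\<lambda>t. B t * ((cpoly R x - cpoly R t) / (x - t)))"
    "cpoly R x * gint \<Delta> (uc b) (\<lambda>t. B t / (x - t))
      = gint \<Delta> (uc b) (\<lambda>t. cpoly R t * (B t / (x - t)))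
        + gint \<Delta> (uc b) (\<lambda>t. B t * ((cpoly R x - cpoly R t) / (x - t)))" if b: "b \<in> {1, 2}" for b R
  proof -
    have J: "gintegrable \<Delta> (uc b) (\<lambda>t. f t / (x - t))" if "f \<in> range poly" for f
      using b momc x that by (intro gintegrable_range_poly_divide) auto
    show 1: "gintegrable \<Delta> (uc b) (\<lambda>t. cpoly R t * (B t / (x - t)))"
      using J[of "\<lambda>t. cpoly R t * B t"] B by (simp add: range_poly_intros)
    show 2: "gintegrable \<Delta> (uc b) (\<lambda>t. B t * ((cpoly R x - cpoly R t) / (x - t)))"
      using J[of "\<lambda>t. B t * (cpoly R x - cpoly R t)"] B by (simp add: range_poly_intros)
    have "cpoly R x * gint \<Delta> (uc b) (\<lambda>t. B t / (x - t)) = gint \<Delta> (uc b) (\<lambda>t. cpoly R x * (B t / (x - t)))"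
      by (rule gint_cmult[OF J[OF B], symmetric])
    \<comment> \<open>This holds for every t: at t = x all quotients are 0.\<close>
    also have "(\<lambda>t. cpoly R x * (B t / (x - t)))
        = (\<lambda>t. cpoly R t * (B t / (x - t)) + B t * ((cpoly R x - cpoly R t) / (x - t)))"
      by (simp add: fun_eq_iff diff_divide_distrib right_diff_distrib mult.commute)
    finally show "cpoly R x * gint \<Delta> (uc b) (\<lambda>t. B t / (x - t))
      = gint \<Delta> (uc b) (\<lambda>t. cpoly R t * (B t / (x - t)))
        + gint \<Delta> (uc b) (\<lambda>t. B t * ((cpoly R x - cpoly R t) / (x - t)))"
      by (simp only: gint_add[OF 1 2])
  qed
  show ?thesis
    using gint_poly_combination[OF eq v I(1) I(1)] by (simp add: I(3))
qed

text \<open>The splitting of the Cauchy integrals is applied to each polynomial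
  \<open>Bpol S t l\<close>, weighted by \<open>Apol\<close> and summed. Leaving \<open>R1\<close>,
  \<open>R2\<close> and \<open>v\<close> free covers both columns of W(x).\<close>

lemma mixed_kernel_combination:
  assumes momc: "finite_moments \<Delta> (uc 1)" "finite_moments \<Delta> (uc 2)"
    and eq: "gw_eq_on \<Delta> (gw_add (gw_poly_mult R1 (uc 1)) (gw_poly_mult R2 (uc 2))) v"
    and v: "\<And>f. f \<in> range poly \<Longrightarrow> gintegrable \<Delta> v (\<lambda>t. f t / (x - t))"
    and x: "x \<in> cauchy_domain \<Delta> uc" and S: "lower_tri S"
  shows "mixed_kernel \<Delta> uc S H S' n a 1 x y * cpoly R1 x + mixed_kernel \<Delta> uc S H S' n a 2 x y * cpoly R2 x
    = (\<Sum>l<n. gint \<Delta> v (\<lambda>t. Bpol S t l / (x - t)) * Apol H S' a y l)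
      + kernel_correction \<Delta> uc S H S' n R1 a 1 x y + kernel_correction \<Delta> uc S H S' n R2 a 2 x y"
proof -
  note B = Bpol_range_poly[OF S]
  \<comment> \<open>The correction has its sum over l under the integral sign; it is moved outside
    to match the kernel.\<close>
  have corr: "kernel_correction \<Delta> uc S H S' n R a b x y
      = (\<Sum>l<n. Apol H S' a y l * gint \<Delta> (uc b) (\<lambda>t. Bpol S t l * ((cpoly R x - cpoly R t) / (x - t))))"
    if b: "b \<in> {1, 2}" for b R
  proof -
    have "kernel_correction \<Delta> uc S H S' n R a b x y = gint \<Delta> (uc b) (\<lambda>t. \<Sum>l<n. Apol H S' a y l *
        (Bpol S t l * ((cpoly R x - cpoly R t) / (x - t))))"
      by (simp add: kernel_correction_def sum_distrib_left sum_distrib_right sum_divide_distrib mult_ac)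
    also have "\<dots> = (\<Sum>l<n. Apol H S' a y l *
        gint \<Delta> (uc b) (\<lambda>t. Bpol S t l * ((cpoly R x - cpoly R t) / (x - t))))"
    proof (rule gint_linear_combination)
      show "finite {\<zeta>. point_masses (uc b) \<zeta> \<noteq> 0}"
        using b momc by (auto simp: finite_moments_def)
      show "gintegrable \<Delta> (uc b) (\<lambda>t. Bpol S t l * ((cpoly R x - cpoly R t) / (x - t)))" for l
      proof -
        have "(\<lambda>t. Bpol S t l * (cpoly R x - cpoly R t)) \<in> range poly"
          by (intro range_poly_intros B)
        with gintegrable_range_poly_divide[OF _ b x this] b momc show ?thesis
          by auto
      qed
    qed
    finally show ?thesis .
  qed
  have "mixed_kernel \<Delta> uc S H S' n a 1 x y * cpoly R1 x + mixed_kernel \<Delta> uc S H S' n a 2 x y * cpoly R2 x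
      = (\<Sum>l<n. Apol H S' a y l * (cpoly R1 x * gint \<Delta> (uc 1) (\<lambda>t. Bpol S t l / (x - t))
          + cpoly R2 x * gint \<Delta> (uc 2) (\<lambda>t. Bpol S t l / (x - t))))"
    by (simp add: mixed_kernel_def second_kind_def sum_distrib_left sum_distrib_right sum.distrib
        distrib_left mult_ac)
  also have "\<dots> = (\<Sum>l<n. Apol H S' a y l * (gint \<Delta> v (\<lambda>t. Bpol S t l / (x - t))
      + gint \<Delta> (uc 1) (\<lambda>t. Bpol S t l * ((cpoly R1 x - cpoly R1 t) / (x - t)))
      + gint \<Delta> (uc 2) (\<lambda>t. Bpol S t l * ((cpoly R2 x - cpoly R2 t) / (x - t)))))"
    by (simp only: gint_Cauchy_combination[OF momc eq v[OF B] x B])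
  also have "\<dots> = (\<Sum>l<n. gint \<Delta> v (\<lambda>t. Bpol S t l / (x - t)) * Apol H S' a y l)
      + kernel_correction \<Delta> uc S H S' n R1 a 1 x y + kernel_correction \<Delta> uc S H S' n R2 a 2 x y"
    by (simp add: corr sum.distrib distrib_left mult.commute)
  finally show ?thesis .
qed

context shifted_moments
begin

text \<open>From Omega S = Sc the perturbed polynomials are finite combinations of the original
  ones, and the integral against the original weight is linear.\<close>

lemma gint_Bpol_Omega:
  assumes mom: "finite_moments \<Delta> (u b)" and b: "b \<in> {1, 2}" and x: "x \<in> cauchy_domain \<Delta> u"
  shows "gint \<Delta> (u b) (\<lambda>t. Bpol Sc t l / (x - t)) = (\<Sum>k\<le>l. Omega l k * second_kind \<Delta> u S b x k)"
proof -
  have "Bpol Sc t l = (\<Sum>k\<le>l. Omega l k * Bpol S t k)" for t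
  proof -
    have "Omega \<star>\<^sub>v Bpol S t = (Omega \<star> S) \<star>\<^sub>v Xvec t"
      by (simp add: Bpol_def imat_vec_assoc lower lower_Omega)
    then have "Bpol Sc t = Omega \<star>\<^sub>v Bpol S t"
      by (simp add: Omega_mult_S Bpol_def)
    then show ?thesis
      by (simp add: imat_vec_lower lower_Omega)
  qed
  then have "(\<lambda>t. Bpol Sc t l / (x - t)) = (\<lambda>t. \<Sum>k\<le>l. Omega l k * (Bpol S t k / (x - t)))"
    by (simp add: sum_divide_distrib)
  then show ?thesis
    using assms unfolding second_kind_def
    by (simp only:) (intro gint_linear_combination gintegrable_range_poly_divide Bpol_range_poly lower;
        simp add: finite_moments_def)
qed

text \<open>\<open>Omega\<close> moves from the second kind functions to the
  \<open>A\<close>-vectors by \<open>banded_partial_sum\<close>; the complete column sums collapse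
  by \<open>Omega_transpose_vec\<close>. The pair \<open>e1\<close>, \<open>e2\<close> stands for
  either row of W(y).\<close>

lemma kernel_sum_exchange:
  assumes n: "d \<le> n" and shift: "\<And>k. (\<Sum>m\<le>d. q m * Xvec_part a y (k + m))
      = e1 * Xvec_part 1 y k + e2 * Xvec_part 2 y k"
  shows "(\<Sum>l<n. (\<Sum>k\<le>l. Omega l k * second_kind \<Delta> u S b x k) * Apol Hc Stc a y l)
    = e1 * mixed_kernel \<Delta> u S H St n 1 b x y + e2 * mixed_kernel \<Delta> u S H St n 2 b x y
      - (\<Sum>j<d. (\<Sum>i<d. Apol Hc Stc a y (n + i) * Omega (n + i) (n - d + j))
          * second_kind \<Delta> u S b x (n - d + j))"
proof -
  have transpose: "(\<Sum>l\<le>k + d. Omega l k * Apol Hc Stc a y l) = e1 * Apol H St 1 y k + e2 * Apol H St 2 y k" for k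
    unfolding Apol_def Omega_transpose_vec shift
    by (simp add: nonsing_diag_vec imat_inv_diag diag imat_vec_lower
        lower distrib_left sum.distrib sum_distrib_left add_divide_distrib mult_ac)
  show ?thesis
    by (subst banded_partial_sum[OF lower_Omega Omega_banded n])
       (simp_all add: transpose mixed_kernel_def sum_distrib_left sum.distrib distrib_left mult_ac)
qed

end

section \<open>The kernel formula\<close>

lemma mat22_entry: "i < 2 \<Longrightarrow> j < 2 \<Longrightarrow>
    mat22 a b c d $$ (i, j) = (if i = 0 then if j = 0 then a else b else if j = 0 then c else d)"
  by (auto simp: mat_of_rows_list_def less_2_cases_iff)

lemma mat22_dim: "dim_row (mat22 a b c d) = 2" "dim_col (mat22 a b c d) = 2"
  by (simp_all add: mat_of_rows_list_def)

lemma mat22_eqI: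
  assumes "dim_row A = 2" "dim_col A = 2"
    "A $$ (0, 0) = a" "A $$ (0, 1) = b" "A $$ (1, 0) = c" "A $$ (1, 1) = d"
  shows "A = mat22 a b c d"
  using assms by (intro eq_matI) (auto simp: mat22_entry mat22_dim less_2_cases_iff)

lemma mat22_mult:
  "mat22 a b c d * mat22 a' b' c' d'
    = mat22 (a * a' + b * c') (a * b' + b * d') (c * a' + d * c') (c * b' + d * d')"
proof -
  have sum2: "(\<Sum>i = 0..<2. f i) = f 0 + f (Suc 0)" for f :: ivec
    by (simp add: numeral_2_eq_2)
  show ?thesis
    by (rule mat22_eqI) (simp_all add: mat22_entry mat22_dim scalar_prod_def sum2)
qed

lemma mat22_add: "mat22 a b c d + mat22 a' b' c' d' = mat22 (a + a') (b + b') (c + c') (d + d')"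
  by (rule mat22_eqI) (simp_all add: mat22_entry mat22_dim)

lemma mat22_diff: "mat22 a b c d - mat22 a' b' c' d' = mat22 (a - a') (b - b') (c - c') (d - d')"
  by (rule mat22_eqI) (simp_all add: mat22_entry mat22_dim)

lemma mat22_smult: "k \<cdot>\<^sub>m mat22 a b c d = mat22 (k * a) (k * b) (k * c) (k * d)"
  by (rule mat22_eqI) (simp_all add: mat22_entry mat22_dim)

lemma mat22_cong:
  "a = a' \<Longrightarrow> b = b' \<Longrightarrow> c = c' \<Longrightarrow> d = d' \<Longrightarrow> mat22 a b c d = mat22 a' b' c' d'"
  by simp

text \<open>The triple product becomes the double sum of \<open>banded_partial_sum\<close>. The
  offset a + 1 passes from matrix indices starting at 0 to the labels 1 and 2.\<close>

lemma Omega_block_product: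
  fixes A V :: "nat \<Rightarrow> ivec" and W :: imat and n m :: nat
  defines "D \<equiv> \<lambda>a b. \<Sum>j<m. (\<Sum>i<m. A a (n + i) * W (n + i) (n - m + j)) * V b (n - m + j)"
  shows "Matrix.mat 2 m (\<lambda>(a, i). A (a + 1) (n + i)) * transpose_mat (Omega_block W m n)
      * Matrix.mat m 2 (\<lambda>(j, a). V (a + 1) (n - m + j)) = mat22 (D 1 1) (D 1 2) (D 2 1) (D 2 2)"
proof -
  have "(Matrix.mat 2 m (\<lambda>(a, i). A (a + 1) (n + i)) * transpose_mat (Omega_block W m n)
      * Matrix.mat m 2 (\<lambda>(j, a). V (a + 1) (n - m + j))) $$ (a, b) = D (a + 1) (b + 1)"
    if "a < 2" "b < 2" for a b
    using that by (simp add: Omega_block_def scalar_prod_def D_def lessThan_atLeast0 mult.commute)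
  from this[of 0 0] this[of 0 1] this[of 1 0] this[of 1 1] show ?thesis
    by (intro mat22_eqI) (simp_all add: numeral_2_eq_2)
qed

lemma degree_linear_product:
  assumes "map_poly of_real P = (\<Prod>i=1..N. [:- f i :: complex, 1:])"
  shows "degree (P :: real poly) = N"
proof -
  have "degree P = degree (map_poly of_real P :: complex poly)"
    by (simp add: degree_map_poly)
  then show ?thesis
    by (simp add: assms degree_prod_eq_sum_degree)
qed

text \<open>The common factor p(z^2) comes out of both parts; it accounts for the summand 2M in the
  bandwidth \<open>Nt\<close>.\<close>

lemma degree_even_odd_poly_mult:
  "degree (even_odd_poly (p * E) (p * F)) \<le> 2 * degree p + degree (even_odd_poly E F)"
proof -
  have "even_odd_poly (p * E) (p * F) = pcompose p [:0, 0, 1:] * even_odd_poly E F"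
    by (simp add: pcompose_mult algebra_simps)
  also have "degree \<dots> \<le> degree (pcompose p [:0, 0, 1:]) + degree (even_odd_poly E F)"
    by (rule degree_mult_le)
  also have "degree (pcompose p [:0, 0, 1:]) = 2 * degree p"
    by (simp add: degree_pcompose)
  finally show ?thesis .
qed

theorem theorem12:
  fixes \<Delta> :: "real set"
    and w :: "nat \<Rightarrow> real \<Rightarrow> real"
    and N M n :: nat
    and xr r :: "nat \<Rightarrow> complex"
    and P p Pe Po :: "real poly"
    and c :: "nat \<Rightarrow> complex \<Rightarrow> complex"
    and S H St Sc Hc Stc :: imat
    and x y :: complex
  defines "Nt \<equiv> 2 * M + N"
    and "Pet \<equiv> p * Pe"
    and "Pot \<equiv> p * Po"
    and "Z \<equiv> (\<lambda>j. (r j)\<^sup>2) ` {1..M} \<union> (\<lambda>i. (xr i)\<^sup>2) ` {1..N}"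
  defines "u \<equiv> (\<lambda>a. no_masses (w a))"
    and "uc \<equiv> geronimus_weight w Pe Po p Z c"
    and "\<Omega> \<equiv> Sc \<star> imat_inv S"
  defines "K \<equiv> mixed_kernel \<Delta> u S H St n"
    and "Kc \<equiv> mixed_kernel \<Delta> uc Sc Hc Stc n"
    and "\<V> \<equiv> kernel_correction \<Delta> uc Sc Hc Stc n"
    and "V \<equiv> Vfun Pe Po (second_kind \<Delta> u S)"
    and "Ac \<equiv> Apol Hc Stc"
  assumes "is_interval \<Delta>"
    and "\<And>a. a \<in> {1, 2} \<Longrightarrow> finite_moments \<Delta> (u a)"
    and "map_poly of_real P = (\<Prod>i=1..N. [:- xr i, 1:])"
    and "nonsymmetric P"
    and "map_poly of_real p = (\<Prod>j=1..M. [:- ((r j)\<^sup>2), 1:])"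
    and "P = pcompose Pe [:0, 0, 1:] + [:0, 1:] * pcompose Po [:0, 0, 1:]"
    and "distinct (map (\<lambda>j. (r j)\<^sup>2) [1..<M + 1] @ map (\<lambda>i. (xr i)\<^sup>2) [1..<N + 1])"
    and "geronimus_equation \<Delta> w Pet Pot uc"
    and "\<And>a. a \<in> {1, 2} \<Longrightarrow> finite_moments \<Delta> (uc a)"
    and "LDU_factorization (moment_matrix \<Delta> u) S H St"
    and "LDU_factorization (moment_matrix \<Delta> uc) Sc Hc Stc"
    and "n \<ge> Nt"
    and "x \<in> cauchy_domain \<Delta> u" and "x \<in> cauchy_domain \<Delta> uc"
  shows
    "(cpoly (pi_poly Pe Po) x * cpoly p x) \<cdot>\<^sub>m
       mat22 (Kc 1 1 x y) (Kc 1 2 x y)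
             (Kc 2 1 x y) (Kc 2 2 x y)
     = mat22 (cpoly Pet y) (y * cpoly Pot y)
             (cpoly Pot y) (cpoly Pet y)
       * mat22 (K 1 1 x y) (K 1 2 x y)
               (K 2 1 x y) (K 2 2 x y)
       * mat22 (cpoly Pe x) (- x * cpoly Po x)
               (- cpoly Po x) (cpoly Pe x)
     + mat22 (\<V> Pet 1 1 x y + \<V> Pot 1 2 x y) (\<V> ([:0, 1:] * Pot) 1 1 x y + \<V> Pet 1 2 x y)
             (\<V> Pet 2 1 x y + \<V> Pot 2 2 x y) (\<V> ([:0, 1:] * Pot) 2 1 x y + \<V> Pet 2 2 x y)
       * mat22 (cpoly Pe x) (- x * cpoly Po x)
               (- cpoly Po x) (cpoly Pe x)
     - Matrix.mat 2 Nt (\<lambda>(a, i). Ac (a + 1) y (n + i))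
       * transpose_mat (Omega_block \<Omega> Nt n)
       * Matrix.mat Nt 2 (\<lambda>(j, a). V (a + 1) x (n - Nt + j))"
proof -
  note mom = assms(14) and P = assms(15) and p = assms(17) and PE = assms(18) and geq = assms(20)
    and momc = assms(21) and LDU = assms(22) and LDUc = assms(23) and n = assms(24)
    and x = assms(25) and xc = assms(26)
  have one: "1 \<in> {1, 2 :: nat}" and two: "2 \<in> {1, 2 :: nat}"
    by simp_all
  have deg: "degree (even_odd_poly Pet Pot) \<le> Nt"
    using degree_even_odd_poly_mult[of p Pe Po] degree_linear_product[OF p] degree_linear_product[OF P]
    unfolding Pet_def Pot_def Nt_def PE[symmetric] by simp
  have eq1: "gw_eq_on \<Delta> (gw_add (gw_poly_mult Pet (uc 1)) (gw_poly_mult Pot (uc 2))) (u 1)"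
    and eq2: "gw_eq_on \<Delta> (gw_add (gw_poly_mult ([:0, 1:] * Pot) (uc 1)) (gw_poly_mult Pet (uc 2))) (u 2)"
    using geq by (simp_all only: geronimus_equation_def u_def)
  interpret sm: shifted_moments "moment_matrix \<Delta> u" S H St "moment_matrix \<Delta> uc" Sc Hc Stc
    "\<lambda>m. of_real (coeff (even_odd_poly Pet Pot) m)" Nt
    by unfold_locales (fact LDU, fact LDUc, rule moment_matrix_shift[OF mom momc eq1 eq2 deg])
  have Om: "sm.Omega = \<Omega>"
    by (simp add: sm.Omega_def \<Omega>_def)
  define C where "C = second_kind \<Delta> u S"
  \<comment> \<open>The boundary term before multiplication by the adjugate, with plain second kind
    functions in place of \<open>V\<close>.\<close>
  define D where "D a b = (\<Sum>j<Nt. (\<Sum>i<Nt. Ac a y (n + i) * \<Omega> (n + i) (n - Nt + j)) * C b x (n - Nt + j))"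
    for a b
  have int: "gintegrable \<Delta> (u b) (\<lambda>t. f t / (x - t))" if "b \<in> {1, 2}" "f \<in> range poly" for b f
    using that mom x by (intro gintegrable_range_poly_divide) auto
  have L: "(\<Sum>l<n. gint \<Delta> (u b) (\<lambda>t. Bpol Sc t l / (x - t)) * Ac a y l)
      = e1 * K 1 b x y + e2 * K 2 b x y - D a b"
    if b: "b \<in> {1, 2}" and shift: "\<And>k. (\<Sum>m\<le>Nt. of_real (coeff (even_odd_poly Pet Pot) m) * Xvec_part a y (k + m))
      = e1 * Xvec_part 1 y k + e2 * Xvec_part 2 y k" for a b e1 e2
    unfolding sm.gint_Bpol_Omega[OF mom[OF b] b x] Ac_def sm.kernel_sum_exchange[OF n shift]
    by (simp only: K_def D_def C_def Ac_def Om)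
  note shift = Xvec_part_poly_shift[OF deg, of y]
  \<comment> \<open>\<open>col1\<close> and \<open>col2\<close> give the two columns of the
    perturbed kernel matrix times W(x), one row \<open>a\<close> at a time.\<close>
  have col1: "Kc a 1 x y * cpoly Pet x + Kc a 2 x y * cpoly Pot x = e1 * K 1 1 x y + e2 * K 2 1 x y - D a 1
      + \<V> Pet a 1 x y + \<V> Pot a 2 x y"
    if "\<And>k. (\<Sum>m\<le>Nt. of_real (coeff (even_odd_poly Pet Pot) m) * Xvec_part a y (k + m))
      = e1 * Xvec_part 1 y k + e2 * Xvec_part 2 y k" for a e1 e2
    using mixed_kernel_combination[where n = n and H = Hc and S' = Stc and a = a and y = y,
      OF momc[OF one] momc[OF two] eq1 int[OF one] xc sm.lower(3)]
    unfolding L[OF one that, unfolded Ac_def] Kc_def \<V>_def by simp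
  have col2: "Kc a 1 x y * (x * cpoly Pot x) + Kc a 2 x y * cpoly Pet x = e1 * K 1 2 x y + e2 * K 2 2 x y - D a 2
      + \<V> ([:0, 1:] * Pot) a 1 x y + \<V> Pet a 2 x y"
    if "\<And>k. (\<Sum>m\<le>Nt. of_real (coeff (even_odd_poly Pet Pot) m) * Xvec_part a y (k + m))
      = e1 * Xvec_part 1 y k + e2 * Xvec_part 2 y k" for a e1 e2
    using mixed_kernel_combination[where n = n and H = Hc and S' = Stc and a = a and y = y,
      OF momc[OF one] momc[OF two] eq2 int[OF two] xc sm.lower(3)]
    unfolding L[OF two that, unfolded Ac_def] Kc_def \<V>_def by (simp add: map_poly_pCons)
  \<comment> \<open>The functions \<open>V\<close> arise from the second kind functions by the
    adjugate factor, so this factor passes through the boundary sum.\<close>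
  have V: "(\<Sum>j<Nt. (\<Sum>i<Nt. Ac a y (n + i) * \<Omega> (n + i) (n - Nt + j)) * V b x (n - Nt + j))
      = (if b = 1 then cpoly Pe x * D a 1 - cpoly Po x * D a 2
         else - x * cpoly Po x * D a 1 + cpoly Pe x * D a 2)" for a b
    unfolding V_def Vfun_def D_def C_def
    by (cases "b = 1") (simp_all add: sum_distrib_left sum_subtractf sum.distrib sum_negf algebra_simps)
  have pi: "cpoly (pi_poly Pe Po) x = cpoly Pe x ^ 2 - x * cpoly Po x ^ 2"
    by (simp add: pi_poly_def power2_eq_square cpoly_arith map_poly_pCons)
  \<comment> \<open>W(x) times the adjugate without its factor p(x) is \<pi>(x) p(x) times the
    identity. No division occurs, so zeros of this product need no separate treatment.\<close>
  have adj: "cpoly (pi_poly Pe Po) x * cpoly p x * k1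
      = (k1 * cpoly Pet x + k2 * cpoly Pot x) * cpoly Pe x
        - (k1 * (x * cpoly Pot x) + k2 * cpoly Pet x) * cpoly Po x"
    "cpoly (pi_poly Pe Po) x * cpoly p x * k2
      = (k1 * (x * cpoly Pot x) + k2 * cpoly Pet x) * cpoly Pe x
        - (k1 * cpoly Pet x + k2 * cpoly Pot x) * (x * cpoly Po x)" for k1 k2
    unfolding pi Pet_def Pot_def by (simp_all add: cpoly_arith power2_eq_square algebra_simps)
  have row: "cpoly (pi_poly Pe Po) x * cpoly p x * Kc a 1 x y
      = (e1 * K 1 1 x y + e2 * K 2 1 x y) * cpoly Pe x + (e1 * K 1 2 x y + e2 * K 2 2 x y) * - cpoly Po x
        + ((\<V> Pet a 1 x y + \<V> Pot a 2 x y) * cpoly Pe x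
          + (\<V> ([:0, 1:] * Pot) a 1 x y + \<V> Pet a 2 x y) * - cpoly Po x)
        - (cpoly Pe x * D a 1 - cpoly Po x * D a 2)"
    "cpoly (pi_poly Pe Po) x * cpoly p x * Kc a 2 x y
      = (e1 * K 1 1 x y + e2 * K 2 1 x y) * (- x * cpoly Po x) + (e1 * K 1 2 x y + e2 * K 2 2 x y) * cpoly Pe x
        + ((\<V> Pet a 1 x y + \<V> Pot a 2 x y) * (- x * cpoly Po x)
          + (\<V> ([:0, 1:] * Pot) a 1 x y + \<V> Pet a 2 x y) * cpoly Pe x)
        - (- x * cpoly Po x * D a 1 + cpoly Pe x * D a 2)"
    if shift: "\<And>k. (\<Sum>m\<le>Nt. of_real (coeff (even_odd_poly Pet Pot) m) * Xvec_part a y (k + m))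
      = e1 * Xvec_part 1 y k + e2 * Xvec_part 2 y k" for a e1 e2
    unfolding adj(1)[of "Kc a 1 x y" "Kc a 2 x y"] adj(2)[of "Kc a 2 x y" "Kc a 1 x y"]
      col1[OF shift] col2[OF shift]
    by (simp_all only: ring_distribs mult_minus_left mult_minus_right mult_ac, simp_all)
  show ?thesis
    unfolding Omega_block_product[where A = "\<lambda>a. Ac a y" and V = "\<lambda>a. V a x"] V
      mat22_mult mat22_smult mat22_add mat22_diff
    \<comment> \<open>\<open>shift(1)\<close> supplies the first row of W(y) for a = 1,
      \<open>shift(2)\<close> the second for a = 2.\<close>
    by (rule mat22_cong; simp only: row[OF shift(1)] row[OF shift(2)]; simp)
qed

end
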